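(* Let $D$ be a simply connected hyperbolic domain and let $\{g_t\}_{t\ge0}$ and $\{\tilde g_{\tilde t}\}_{\tilde t\ge0}$ be normalized slit Löwner chains in $D$ driven by $b,\sigma,u$ and by $b,\sigma,\tilde u$ respectively (same $b$ and $\sigma$). Suppose there is a continuous monotone function $\lambda$ (with $\lambda(0)=0$) such that $\tilde g_{\lambda(t)}^{-1}(D)=g_t^{-1}(D)$ for all $t\in[0,\infty)$. Then $\lambda(t)=t$, $\tilde u_{\lambda(t)}=u_t$ and $g_t=\tilde g_{\lambda(t)}$ for all $t\in[0,\infty)$.
   Context: Pushforward: $(\phi_*V)(z)=\phi'(\phi^{-1}(z))V(\phi^{-1}(z))$. $\ell_n:=\phi_*\ell_n^{\mathbb{H}}$ with $\ell_n^{\mathbb{H}}(z)=-z^{n+1}$ and a fixed conformal $\phi:\mathbb{H}\to D$. A normalized slit Löwner chain in $D$ driven by $b,\sigma,u$: $b=2\ell_{-2}+b_{-1}\ell_{-1}+b_0\ell_0+b_1\ell_1$, $\sigma=\ell_{-1}+\sigma_0\ell_0+\sigma_1\ell_1$ (real coefficients); $\{h_t\}$ the automorphism flow of $\sigma$; $u$ continuous real, $u_0=0$; $g_t$ solves $\partial_tg_t(z)=-\frac{1}{h'_{u_t}(g_t(z))}b(h_{u_t}(g_t(z)))$, $g_0(z)=z$, and maps its domain of existence $D_t=g_t^{-1}(D)$ conformally onto $D$. *)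

theory Defs
  imports "HOL-Analysis.Analysis"
begin

definition upper_half :: "complex set" where
  "upper_half = {z. Im z > 0}"

definition pushfwd :: "(complex \<Rightarrow> complex) \<Rightarrow> (complex \<Rightarrow> complex) \<Rightarrow> complex \<Rightarrow> complex" where
  "pushfwd \<phi> V z = deriv \<phi> (inv_into upper_half \<phi> z) * V (inv_into upper_half \<phi> z)"

definition ellH :: "int \<Rightarrow> complex \<Rightarrow> complex" where
  "ellH n z = - (z powi (n + 1))"

definition ell :: "(complex \<Rightarrow> complex) \<Rightarrow> int \<Rightarrow> complex \<Rightarrow> complex" where
  "ell \<phi> n = pushfwd \<phi> (ellH n)"

definition loewner_b :: "(complex \<Rightarrow> complex) \<Rightarrow> real \<Rightarrow> real \<Rightarrow> real \<Rightarrow> complex \<Rightarrow> complex" where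
  "loewner_b \<phi> bm1 b0 b1 z =
     2 * ell \<phi> (-2) z + of_real bm1 * ell \<phi> (-1) z + of_real b0 * ell \<phi> 0 z + of_real b1 * ell \<phi> 1 z"

definition loewner_sigma :: "(complex \<Rightarrow> complex) \<Rightarrow> real \<Rightarrow> real \<Rightarrow> complex \<Rightarrow> complex" where
  "loewner_sigma \<phi> s0 s1 z = ell \<phi> (-1) z + of_real s0 * ell \<phi> 0 z + of_real s1 * ell \<phi> 1 z"

definition aut_flow :: "complex set \<Rightarrow> (complex \<Rightarrow> complex) \<Rightarrow> (real \<Rightarrow> complex \<Rightarrow> complex) \<Rightarrow> bool" where
  "aut_flow D V h \<longleftrightarrow>
     (\<forall>z\<in>D. h 0 z = z) \<and>
     (\<forall>s. \<forall>z\<in>D. h s z \<in> D \<and> ((\<lambda>r. h r z) has_vector_derivative V (h s z)) (at s))"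

definition loewner_vf :: "(complex \<Rightarrow> complex) \<Rightarrow> (real \<Rightarrow> complex \<Rightarrow> complex) \<Rightarrow> (real \<Rightarrow> real)
    \<Rightarrow> real \<Rightarrow> complex \<Rightarrow> complex" where
  "loewner_vf b h u s w = - b (h (u s) w) / deriv (h (u s)) w"

definition ode_sol :: "complex set \<Rightarrow> (real \<Rightarrow> complex \<Rightarrow> complex) \<Rightarrow> complex \<Rightarrow> real \<Rightarrow> (real \<Rightarrow> complex) \<Rightarrow> bool" where
  "ode_sol D F z t \<gamma> \<longleftrightarrow> \<gamma> 0 = z \<and>
     (\<forall>s\<in>{0..t}. \<gamma> s \<in> D \<and> (\<gamma> has_vector_derivative F s (\<gamma> s)) (at s within {0..t}))"

definition loewner_dom :: "complex set \<Rightarrow> (complex \<Rightarrow> complex) \<Rightarrow> (real \<Rightarrow> complex \<Rightarrow> complex)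
    \<Rightarrow> (real \<Rightarrow> real) \<Rightarrow> real \<Rightarrow> complex set" where
  "loewner_dom D b h u t = {z\<in>D. \<exists>\<gamma>. ode_sol D (loewner_vf b h u) z t \<gamma>}"

text \<open>g is a normalized Loewner chain in D driven by b, sigma (through its flow h) and u:
  u continuous with u_0 = 0, g_t(z) is the value at time t of the solution of the
  Loewner equation started at z, and g_t maps D_t conformally onto D.\<close>
definition loewner_chain :: "complex set \<Rightarrow> (complex \<Rightarrow> complex) \<Rightarrow> (real \<Rightarrow> complex \<Rightarrow> complex)
    \<Rightarrow> (real \<Rightarrow> real) \<Rightarrow> (real \<Rightarrow> complex \<Rightarrow> complex) \<Rightarrow> bool" where
  "loewner_chain D b h u g \<longleftrightarrow>
     continuous_on {0..} u \<and> u 0 = 0 \<and>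
     (\<forall>t\<ge>0.
        (\<forall>z\<in>loewner_dom D b h u t. \<exists>\<gamma>. ode_sol D (loewner_vf b h u) z t \<gamma> \<and> g t z = \<gamma> t) \<and>
        (g t) holomorphic_on loewner_dom D b h u t \<and>
        bij_betw (g t) (loewner_dom D b h u t) D)"

end

theory Submission
  imports Defs "HOL-Complex_Analysis.Complex_Analysis"
begin

text \<open>In half-plane coordinates the flow of sigma consists of real Moebius maps, so the Loewner field is
  a real quadratic polynomial plus the pullback of 2/z under such a map. Since g_t and gt_(lam t)
  have the same domain, they differ by an automorphism of the half plane, which preserves cross
  ratios. For four trajectories the quadratic part of the field drops out of the logarithmic
  derivative of the cross ratio, and what remains is explicit and nonzero. Hence lam is
  differentiable, and lam' is the same quotient for every choice of four trajectories. Comparing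
  two choices determines the pole of the field of gt at time lam t. With E the distance between
  five pairs of corresponding trajectories this gives ut (lam t) - u t = O(E) and
  lam' - 1 = O(E), so E' = O(E), and E = 0 by Gronwall as soon as E vanishes at one time; the
  coincidence then propagates from t = 0.\<close>

section \<open>The vector fields in half-plane coordinates\<close>

text \<open>Neither \<open>lam\<close> nor the driving functions are known to be differentiable. So
  the equation of \<open>gt\<close> cannot be pulled back along \<open>lam\<close> at once, and the
  difference of the driving functions cannot be the Gronwall variable: it has to be recovered
  algebraically from positions of trajectories. Five is the number that allows this: a cross ratio
  takes four points, and the fifth, exchanged for one of them, gives a second cross ratio sharing
  three points.

  The normalization of sigma enters where positions are turned into driving values. Since the
  coefficient of \<open>ell \<phi> (-1)\<close> is 1, the pole moves with nonzero speed in the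
  driving parameter. For negative \<open>kap\<close> it returns periodically, so it fixes the
  parameter only near a known value. This, and constants in O(E) that hold only just to the right of
  the base time, makes the coincidence a local statement that must then be continued.

  A separate obstacle is that the comparison automorphism needs a holomorphic inverse of
  \<open>g t\<close>, hence an open domain, which the notion of a chain does not state. It is
  extracted from the growth of hyperbolic distances.\<close>

text \<open>The entire functions cosh (sqrt k * t) and sinh (sqrt k * t) / sqrt k, for real k of any sign.\<close>

definition gcosh :: "real \<Rightarrow> real \<Rightarrow> real" where
  "gcosh k t = (if k > 0 then cosh (sqrt k * t) else if k = 0 then 1 else cos (sqrt (-k) * t))"

definition gsinh :: "real \<Rightarrow> real \<Rightarrow> real" where
  "gsinh k t = (if k > 0 then sinh (sqrt k * t) / sqrt k else if k = 0 then t
                else sin (sqrt (-k) * t) / sqrt (-k))"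

lemma gcosh_0 [simp]: "gcosh k 0 = 1"
  by (simp add: gcosh_def)

lemma gsinh_0 [simp]: "gsinh k 0 = 0"
  by (simp add: gsinh_def)

lemma DERIV_gcosh: "(gcosh k has_real_derivative k * gsinh k t) (at t)"
proof -
  consider "k > 0" | "k = 0" | "k < 0" by linarith
  then show ?thesis
  proof cases
    case 1
    then have "gcosh k = (\<lambda>t. cosh (sqrt k * t))"
      by (auto simp: gcosh_def)
    with 1 show ?thesis
      by (auto intro!: derivative_eq_intros simp: gsinh_def field_simps)
  next
    case 2
    then have "gcosh k = (\<lambda>t. 1)"
      by (auto simp: gcosh_def)
    with 2 show ?thesis by simp
  next
    case 3
    then obtain r where "r > 0" "k = - (r * r)"
      using that[of "sqrt (-k)"] by auto
    then have "gcosh k = (\<lambda>t. cos (r * t))"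
      and "gsinh k t = sin (r * t) / r"
      by (auto simp: gcosh_def gsinh_def not_less)
    with \<open>r > 0\<close> \<open>k = - (r * r)\<close> show ?thesis
      by (auto intro!: derivative_eq_intros)
  qed
qed

lemma DERIV_gsinh: "(gsinh k has_real_derivative gcosh k t) (at t)"
proof -
  consider "k > 0" | "k = 0" | "k < 0" by linarith
  then show ?thesis
  proof cases
    case 1
    then have "gsinh k = (\<lambda>t. sinh (sqrt k * t) / sqrt k)"
      by (auto simp: gsinh_def)
    with 1 show ?thesis
      by (auto intro!: derivative_eq_intros simp: gcosh_def field_simps)
  next
    case 2
    then have "gsinh k = (\<lambda>t. t)"
      by (auto simp: gsinh_def)
    with 2 show ?thesis by (simp add: gcosh_def)
  next
    case 3
    then obtain r where "r > 0" "k = - (r * r)"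
      using that[of "sqrt (-k)"] by auto
    then have "gsinh k = (\<lambda>t. sin (r * t) / r)"
      and "gcosh k t = cos (r * t)"
      by (auto simp: gsinh_def gcosh_def not_less)
    with \<open>r > 0\<close> \<open>k = - (r * r)\<close> show ?thesis
      by (auto intro!: derivative_eq_intros)
  qed
qed

lemma gcosh_gsinh_square: "(gcosh k t)\<^sup>2 - k * (gsinh k t)\<^sup>2 = 1"
  by (auto simp: gcosh_def gsinh_def power_divide cosh_square_eq sin_squared_eq)

lemma gsinh_diff: "gsinh k (s - t) = gsinh k s * gcosh k t - gcosh k s * gsinh k t"
  by (auto simp: gcosh_def gsinh_def diff_divide_distrib right_diff_distrib sinh_diff sin_diff)

text \<open>w \<mapsto> num s w / den s w is the time s map of the flow of sigma in the half plane, and vf s is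
  minus the pullback of b under it; vfq s is the difference quotient of vf s.\<close>

locale loewner_coeffs =
  fixes bm1 b0 b1 s0 s1 :: real
begin

text \<open>The flow of sigma is generated by the traceless real matrix with rows (-s0/2, -1) and
  (s1, s0/2), whose square is \<open>kap\<close> times the identity. Its exponential is therefore
  \<open>gcosh kap s\<close> times the identity plus \<open>gsinh kap s\<close> times the matrix,
  and \<open>al\<close>, \<open>be\<close>, \<open>ga\<close>, \<open>de\<close> are the
  entries.\<close>

definition kap :: real where "kap = s0\<^sup>2 / 4 - s1"
definition al :: "real \<Rightarrow> real" where "al s = gcosh kap s - s0 / 2 * gsinh kap s"
definition be :: "real \<Rightarrow> real" where "be s = - gsinh kap s"
definition ga :: "real \<Rightarrow> real" where "ga s = s1 * gsinh kap s"
definition de :: "real \<Rightarrow> real" where "de s = gcosh kap s + s0 / 2 * gsinh kap s"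
definition num :: "real \<Rightarrow> complex \<Rightarrow> complex" where "num s w = of_real (al s) * w + of_real (be s)"
definition den :: "real \<Rightarrow> complex \<Rightarrow> complex" where "den s w = of_real (ga s) * w + of_real (de s)"

definition vf :: "real \<Rightarrow> complex \<Rightarrow> complex" where
  "vf s w = 2 * (den s w)^3 / num s w + of_real bm1 * (den s w)\<^sup>2
            + of_real b0 * (num s w * den s w) + of_real b1 * (num s w)\<^sup>2"

definition vfq :: "real \<Rightarrow> complex \<Rightarrow> complex \<Rightarrow> complex" where
  "vfq s w v =
     2 * (of_real (ga s) * num s w * den s v * (den s w + den s v) - (den s w)\<^sup>2) / (num s w * num s v)
     + of_real bm1 * of_real (ga s) * (den s w + den s v)
     + of_real b0 * (of_real (al s) * den s w + of_real (ga s) * num s v)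
     + of_real b1 * of_real (al s) * (num s w + num s v)"

section \<open>Algebra of the Moebius coefficients and of the difference quotient\<close>

lemma det: "al s * de s - be s * ga s = 1"
  using gcosh_gsinh_square[of kap s]
  by (simp add: al_def be_def ga_def de_def kap_def algebra_simps power2_eq_square)

lemma det_complex:
  "complex_of_real (al s) * of_real (de s) - of_real (be s) * of_real (ga s) = 1"
  using det[of s] by (metis of_real_1 of_real_diff of_real_mult)

lemma num_nonzero: "Im w \<noteq> 0 \<Longrightarrow> num s w \<noteq> 0"
  using det[of s] by (auto simp: num_def complex_eq_iff)

lemma den_nonzero: "Im w \<noteq> 0 \<Longrightarrow> den s w \<noteq> 0"
  using det[of s] by (auto simp: den_def complex_eq_iff)

lemma num_diff: "num s w - num s v = of_real (al s) * (w - v)"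
  by (simp add: num_def algebra_simps)

lemma den_diff: "den s w - den s v = of_real (ga s) * (w - v)"
  by (simp add: den_def algebra_simps)

text \<open>With determinant 1, a Moebius map divides a difference w - v by the product of the two
  denominators; this is that rule with denominators cleared.\<close>

lemma num_den_diff: "num s w * den s v - num s v * den s w = w - v"
proof -
  have "num s w * den s v - num s v * den s w
        = (w - v) * (complex_of_real (al s) * of_real (de s) - of_real (be s) * of_real (ga s))"
    by (simp add: num_def den_def algebra_simps)
  then show ?thesis by (simp only: det_complex mult_1_right)
qed

lemma vf_diff:
  assumes "num s w \<noteq> 0" "num s v \<noteq> 0"
  shows "vf s w - vf s v = (w - v) * vfq s w v"
proof -
  define n n' d d' A G where [simp]: "n = num s w" "n' = num s v" "d = den s w" "d' = den s v"
    "A = complex_of_real (al s)" "G = complex_of_real (ga s)"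
  have 1: "n - n' = A * (w - v)" "d - d' = G * (w - v)" "n * d' - n' * d = w - v"
    using num_diff den_diff num_den_diff by auto
  have "d^3 * n' - d'^3 * n = (w - v) * (G * n * d' * (d + d') - d\<^sup>2)"
    using 1 by algebra
  moreover have "n \<noteq> 0" "n' \<noteq> 0" using assms by auto
  ultimately have a: "d^3/n - d'^3/n' = (w - v) * (G * n * d' * (d + d') - d\<^sup>2) / (n * n')"
    by (simp add: divide_simps)
  have b: "d\<^sup>2 - d'\<^sup>2 = (w - v) * (G * (d + d'))" "n * d - n' * d' = (w - v) * (A * d + G * n')"
      "n\<^sup>2 - n'\<^sup>2 = (w - v) * (A * (n + n'))"
    using 1 by algebra+
  have "vf s w - vf s v = 2 * (d^3/n - d'^3/n') + of_real bm1 * (d\<^sup>2 - d'\<^sup>2)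
            + of_real b0 * (n * d - n' * d') + of_real b1 * (n\<^sup>2 - n'\<^sup>2)"
    by (simp add: vf_def algebra_simps)
  also have "\<dots> = (w - v) * vfq s w v"
    unfolding a b vfq_def by (simp add: algebra_simps)
  finally show ?thesis .
qed

text \<open>The difference quotient of a quadratic polynomial is affine in w + v, so its alternating
  sum vanishes. For the bare field 2/z the quotient is -2/(w v), with alternating sum -2 (x1 - x4)
  (x2 - x3) / (x1 x2 x3 x4). Passing to a Moebius pullback divides each difference by two
  denominators, and these turn the product of the images into the product of the numerators.\<close>

lemma vfq_alternating:
  assumes "num s x1 \<noteq> 0" "num s x2 \<noteq> 0" "num s x3 \<noteq> 0" "num s x4 \<noteq> 0"
  shows "vfq s x1 x2 + vfq s x3 x4 - vfq s x1 x3 - vfq s x2 x4 =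
    - 2 * (x1 - x4) * (x2 - x3) / (num s x1 * num s x2 * num s x3 * num s x4)"
proof -
  define n1 n2 n3 n4 d1 d2 d3 d4 A G where
    defs: "n1 = num s x1" "n2 = num s x2" "n3 = num s x3" "n4 = num s x4"
     "d1 = den s x1" "d2 = den s x2" "d3 = den s x3" "d4 = den s x4"
    "A = complex_of_real (al s)" "G = complex_of_real (ga s)"
  have n0: "n1 \<noteq> 0" "n2 \<noteq> 0" "n3 \<noteq> 0" "n4 \<noteq> 0"
    using assms by (auto simp: defs)
  have rel: "A * den s x - G * num s x = 1" for x
    using det_complex[of s] by (simp add: num_def den_def defs algebra_simps)
  have r: "A * d1 - G * n1 = 1" "A * d2 - G * n2 = 1" "A * d3 - G * n3 = 1" "A * d4 - G * n4 = 1"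
    using rel by (auto simp: defs)
  have "n1 * d4 - n4 * d1 = x1 - x4" "n2 * d3 - n3 * d2 = x2 - x3"
    using num_den_diff by (auto simp: defs)
  then have key: "(G * n1 * d2 * (d1 + d2) - d1\<^sup>2) * n3 * n4 + (G * n3 * d4 * (d3 + d4) - d3\<^sup>2) * n1 * n2
     - (G * n1 * d3 * (d1 + d3) - d1\<^sup>2) * n2 * n4 - (G * n2 * d4 * (d2 + d4) - d2\<^sup>2) * n1 * n3
     = - (x1 - x4) * (x2 - x3)"
    using r by algebra
  define X where "X w v = (of_real (ga s) * num s w * den s v * (den s w + den s v) - (den s w)\<^sup>2)
     / (num s w * num s v)" for w v
  have XX: "X x1 x2 + X x3 x4 - X x1 x3 - X x2 x4 = - (x1 - x4) * (x2 - x3) / (n1 * n2 * n3 * n4)"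
    unfolding X_def defs[symmetric] key[symmetric] using n0 by (simp add: divide_simps)
  have "vfq s w v = 2 * X w v
     + of_real bm1 * of_real (ga s) * (den s w + den s v)
     + of_real b0 * (of_real (al s) * den s w + of_real (ga s) * num s v)
     + of_real b1 * of_real (al s) * (num s w + num s v)" for w v
    by (simp add: vfq_def X_def)
  \<comment> \<open>The \<open>b0\<close> part of \<open>vfq\<close> is not written symmetrically,
    so a remainder survives; both brackets in it equal the determinant 1 and cancel.\<close>
  then have "vfq s x1 x2 + vfq s x3 x4 - vfq s x1 x3 - vfq s x2 x4
     = 2 * (X x1 x2 + X x3 x4 - X x1 x3 - X x2 x4)
       + of_real b0 * (A * d3 - G * n3 - (A * d2 - G * n2))"
    by (simp add: defs algebra_simps)
  also have "\<dots> = - 2 * (x1 - x4) * (x2 - x3) / (n1 * n2 * n3 * n4)"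
    unfolding XX r by simp
  finally show ?thesis by (simp add: defs)
qed

lemma cnj_num: "cnj (num s w) = num s (cnj w)"
  by (simp add: num_def)

lemma cnj_den: "cnj (den s w) = den s (cnj w)"
  by (simp add: den_def)

lemma cnj_vf: "cnj (vf s w) = vf s (cnj w)"
  by (simp add: vf_def cnj_num cnj_den)

end

section \<open>Solutions and cross ratios\<close>

lemma nondecreasing_of_derivative_within:
  fixes f :: "real \<Rightarrow> real"
  assumes "a \<le> b"
    and "\<And>t. t \<in> {a..b} \<Longrightarrow> (f has_vector_derivative f' t) (at t within {a..b})"
    and "\<And>t. t \<in> {a..b} \<Longrightarrow> f' t \<ge> 0"
  shows "f a \<le> f b"
proof (cases "a = b")
  case False
  with assms(1) have "a < b" by simp
  then obtain x where "x \<in> {a<..<b}" "f b - f a = (b - a) *\<^sub>R f' x"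
    using mvt_simple[of a b f "\<lambda>t h. h *\<^sub>R f' t"] assms(2)
    by (auto simp: has_vector_derivative_def)
  with \<open>a < b\<close> assms(3)[of x] show ?thesis
    by (smt (verit) greaterThanLessThan_iff atLeastAtMost_iff real_scaleR_def mult_nonneg_nonneg)
qed simp

text \<open>The sum of the squared norms, unlike the norms themselves, is differentiable at zeros;
  damped by an exponential it cannot increase. A whole family is treated at once because the
  derivative of each member is bounded only by the sizes of all of them together.\<close>

lemma gronwall_zero_family:
  fixes f :: "'i \<Rightarrow> real \<Rightarrow> 'a::real_inner"
  assumes der: "\<And>i t. i \<in> I \<Longrightarrow> t \<in> {a..b} \<Longrightarrow> (f i has_vector_derivative f' i t) (at t within {a..b})"
    and bound: "\<And>i t. i \<in> I \<Longrightarrow> t \<in> {a..b} \<Longrightarrow> norm (f' i t) \<le> C * (\<Sum>j\<in>I. norm (f j t))"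
    and start: "\<And>i. i \<in> I \<Longrightarrow> f i a = 0" and I: "finite I" "i \<in> I" and t: "t \<in> {a..b}"
  shows "f i t = 0"
proof -
  \<comment> \<open>The factor \<open>card I\<close> is the price of bounding the square of a sum of
    norms by the sum of their squares.\<close>
  define K where "K = \<bar>C\<bar> * card I"
  define Q where "Q t = (\<Sum>j\<in>I. f j t \<bullet> f j t)" for t
  define \<phi> where "\<phi> t = - (Q t * exp (- (2 * K * t)))" for t
  have "\<phi> a \<le> \<phi> t"
  proof (rule nondecreasing_of_derivative_within[of a t \<phi>])
    fix s assume s: "s \<in> {a..t}"
    with t have s': "s \<in> {a..b}" by auto
    have "((\<lambda>s. f j s \<bullet> f j s) has_vector_derivative (2 * (f j s \<bullet> f' j s))) (at s within {a..t})"
      if "j \<in> I" for j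
    proof -
      have fs: "(f j has_vector_derivative f' j s) (at s within {a..t})"
        using der[OF that s'] by (rule has_vector_derivative_within_subset) (use t in auto)
      from bounded_bilinear.has_vector_derivative[OF bounded_bilinear_inner fs fs]
      show ?thesis by (simp add: inner_commute)
    qed
    then have "(Q has_real_derivative (\<Sum>j\<in>I. 2 * (f j s \<bullet> f' j s))) (at s within {a..t})"
      unfolding Q_def has_real_derivative_iff_has_vector_derivative by (rule has_vector_derivative_sum)
    then show "(\<phi> has_vector_derivative
        (2 * (K * Q s - (\<Sum>j\<in>I. f j s \<bullet> f' j s))) * exp (- (2 * K * s))) (at s within {a..t})"
      unfolding \<phi>_def has_real_derivative_iff_has_vector_derivative[symmetric]
      by (auto intro!: derivative_eq_intros simp: algebra_simps sum_distrib_left)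
    define N where "N = (\<Sum>j\<in>I. norm (f j s))"
    have "N \<ge> 0" by (simp add: N_def sum_nonneg)
    have "f j s \<bullet> f' j s \<le> norm (f j s) * (\<bar>C\<bar> * N)" if "j \<in> I" for j
    proof -
      have "f j s \<bullet> f' j s \<le> norm (f j s) * norm (f' j s)"
        by (rule norm_cauchy_schwarz)
      also have "norm (f' j s) \<le> \<bar>C\<bar> * N"
        using bound[OF that s'] mult_right_mono[OF abs_ge_self[of C] \<open>N \<ge> 0\<close>] by (simp add: N_def)
      finally show ?thesis by (simp add: mult_left_mono)
    qed
    then have "(\<Sum>j\<in>I. f j s \<bullet> f' j s) \<le> (\<Sum>j\<in>I. norm (f j s) * (\<bar>C\<bar> * N))"
      by (rule sum_mono)
    also have "\<dots> = \<bar>C\<bar> * N\<^sup>2"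
      by (simp add: N_def sum_distrib_right[symmetric] power2_eq_square)
    also have "\<dots> \<le> \<bar>C\<bar> * (Q s * card I)"
      unfolding N_def Q_def dot_square_norm
      by (intro mult_left_mono sum_squared_le_sum_of_squares I) auto
    finally show "0 \<le> (2 * (K * Q s - (\<Sum>j\<in>I. f j s \<bullet> f' j s))) * exp (- (2 * K * s))"
      by (simp add: K_def mult_ac)
  qed (use t in auto)
  moreover have "Q t \<ge> 0" unfolding Q_def by (simp add: sum_nonneg)
  ultimately have "Q t = 0"
    using start by (simp add: \<phi>_def Q_def mult_le_0_iff)
  then have "f i t \<bullet> f i t = 0"
    unfolding Q_def using I by (subst (asm) sum_nonneg_eq_0_iff) auto
  then show ?thesis by simp
qed

lemma gronwall_zero:
  fixes f :: "real \<Rightarrow> 'a::real_inner"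
  assumes "\<And>t. t \<in> {a..b} \<Longrightarrow> (f has_vector_derivative f' t) (at t within {a..b})"
    and "\<And>t. t \<in> {a..b} \<Longrightarrow> norm (f' t) \<le> C * norm (f t)"
    and "f a = 0" and "t \<in> {a..b}"
  shows "f t = 0"
  using gronwall_zero_family[of "{()}" a b "\<lambda>_. f" "\<lambda>_. f'" C] assms by simp

section \<open>Trajectories in the half plane\<close>

context loewner_coeffs
begin

lemma continuous_al: "continuous_on A al" and continuous_be: "continuous_on A be"
  and continuous_ga: "continuous_on A ga" and continuous_de: "continuous_on A de"
proof -
  have "continuous_on A (gcosh kap)" "continuous_on A (gsinh kap)"
    using DERIV_gcosh DERIV_gsinh by (meson DERIV_isCont continuous_at_imp_continuous_on)+
  then show "continuous_on A al" "continuous_on A be" "continuous_on A ga" "continuous_on A de"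
    unfolding al_def be_def ga_def de_def by (auto intro!: continuous_intros)
qed

lemma continuous_on_num [continuous_intros]:
  "continuous_on A u \<Longrightarrow> continuous_on A x \<Longrightarrow> continuous_on A (\<lambda>t. num (u t) (x t))"
  unfolding num_def
  by (intro continuous_intros continuous_on_compose2[OF continuous_al[of UNIV]]
      continuous_on_compose2[OF continuous_be[of UNIV]]) auto

lemma continuous_on_den [continuous_intros]:
  "continuous_on A u \<Longrightarrow> continuous_on A x \<Longrightarrow> continuous_on A (\<lambda>t. den (u t) (x t))"
  unfolding den_def
  by (intro continuous_intros continuous_on_compose2[OF continuous_ga[of UNIV]]
      continuous_on_compose2[OF continuous_de[of UNIV]]) auto

definition sol :: "(real \<Rightarrow> real) \<Rightarrow> real \<Rightarrow> (real \<Rightarrow> complex) \<Rightarrow> bool" where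
  "sol u T x \<longleftrightarrow> (\<forall>t\<in>{0..T}. Im (x t) > 0 \<and>
     (x has_vector_derivative vf (u t) (x t)) (at t within {0..T}))"

lemma solD:
  assumes "sol u T x" "t \<in> {0..T}"
  shows "Im (x t) > 0" "(x has_vector_derivative vf (u t) (x t)) (at t within {0..T})"
  using assms by (auto simp: sol_def)

lemma sol_subset:
  assumes "sol u T x" "t \<le> T"
  shows "sol u t x"
  unfolding sol_def
proof safe
  fix s assume s: "s \<in> {0..t}"
  then have "s \<in> {0..T}" using assms by auto
  from solD[OF assms(1) this]
  show "Im (x s) > 0" "(x has_vector_derivative vf (u s) (x s)) (at s within {0..t})"
    using has_vector_derivative_within_subset[of x _ s "{0..T}" "{0..t}"] assms(2) by auto
qed

lemma sol_continuous: "sol u T x \<Longrightarrow> continuous_on {0..T} x"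
  using solD(2) has_vector_derivative_continuous
  by (metis continuous_on_eq_continuous_within)

lemma sol_unique:
  assumes x: "sol u T x" and y: "sol u T y" and u: "continuous_on {0..T} u"
    and "x 0 = y 0" and t: "t \<in> {0..T}"
  shows "x t = y t"
proof -
  \<comment> \<open>\<open>vfq\<close> is an expression without division by w - v, so
    \<open>k\<close> is continuous even where the two solutions meet. Its maximum on the compact
    interval serves as the Lipschitz constant.\<close>
  define k where "k t = vfq (u t) (x t) (y t)" for t
  have nz: "num (u t) (x t) \<noteq> 0" "num (u t) (y t) \<noteq> 0" if "t \<in> {0..T}" for t
    using solD(1)[OF x that] solD(1)[OF y that] by (auto intro!: num_nonzero)
  have ca: "continuous_on {0..T} (\<lambda>t. al (u t))" "continuous_on {0..T} (\<lambda>t. ga (u t))"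
    using u by (auto intro: continuous_on_compose2[OF continuous_al[of UNIV]]
        continuous_on_compose2[OF continuous_ga[of UNIV]])
  have "continuous_on {0..T} k"
    unfolding k_def vfq_def using nz
    by (intro continuous_intros ca u sol_continuous[OF x] sol_continuous[OF y]) auto
  then obtain C where C: "norm (k t) \<le> C" if "t \<in> {0..T}" for t
    using compact_continuous_image[of "{0..T}" k] compact_imp_bounded
    by (metis bounded_iff compact_Icc image_eqI)
  have "x t - y t = 0"
  proof (rule gronwall_zero[where f = "\<lambda>t. x t - y t" and C = C])
    fix t assume t: "t \<in> {0..T}"
    show "((\<lambda>t. x t - y t) has_vector_derivative (vf (u t) (x t) - vf (u t) (y t))) (at t within {0..T})"
      by (intro derivative_intros solD(2)[OF x t] solD(2)[OF y t])
    show "norm (vf (u t) (x t) - vf (u t) (y t)) \<le> C * norm (x t - y t)"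
      using C[OF t] vf_diff[OF nz[OF t]] unfolding k_def
      by (simp add: norm_mult mult.commute[of C] mult_left_mono)
  qed (use assms in auto)
  then show ?thesis by simp
qed

text \<open>The logarithmic derivative of a difference x1 - x2 is vfq; in the alternating sum
  that belongs to a cross ratio the Moebius part of the field cancels.\<close>

lemma cross_ratio_derivative:
  assumes der: "(x1 has_vector_derivative m * vf s (x1 t)) (at t within S)"
      "(x2 has_vector_derivative m * vf s (x2 t)) (at t within S)"
      "(x3 has_vector_derivative m * vf s (x3 t)) (at t within S)"
      "(x4 has_vector_derivative m * vf s (x4 t)) (at t within S)"
    and nz: "num s (x1 t) \<noteq> 0" "num s (x2 t) \<noteq> 0" "num s (x3 t) \<noteq> 0" "num s (x4 t) \<noteq> 0"
    and ne: "x1 t \<noteq> x3 t" "x2 t \<noteq> x4 t"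
  shows "((\<lambda>t. (x1 t - x2 t) * (x3 t - x4 t) / ((x1 t - x3 t) * (x2 t - x4 t))) has_vector_derivative
     m * ((x1 t - x2 t) * (x3 t - x4 t) / ((x1 t - x3 t) * (x2 t - x4 t))) *
     (- 2 * (x1 t - x4 t) * (x2 t - x3 t)
        / (num s (x1 t) * num s (x2 t) * num s (x3 t) * num s (x4 t)))) (at t within S)"
proof -
  define P R where "P t = (x1 t - x2 t) * (x3 t - x4 t)" and "R t = (x1 t - x3 t) * (x2 t - x4 t)" for t
  have d: "((\<lambda>t. y t - z t) has_vector_derivative (y t - z t) * (m * vfq s (y t) (z t))) (at t within S)"
    if "(y has_vector_derivative m * vf s (y t)) (at t within S)"
       "(z has_vector_derivative m * vf s (z t)) (at t within S)" "num s (y t) \<noteq> 0" "num s (z t) \<noteq> 0" for y z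
  proof -
    have "((\<lambda>t. y t - z t) has_vector_derivative m * vf s (y t) - m * vf s (z t)) (at t within S)"
      by (intro derivative_intros that)
    also have "m * vf s (y t) - m * vf s (z t) = m * (vf s (y t) - vf s (z t))"
      by (simp add: algebra_simps)
    also have "\<dots> = (y t - z t) * (m * vfq s (y t) (z t))"
      by (simp add: vf_diff that)
    finally show ?thesis .
  qed
  have dP: "(P has_vector_derivative P t * (m * (vfq s (x1 t) (x2 t) + vfq s (x3 t) (x4 t)))) (at t within S)"
    unfolding P_def
    by (rule has_vector_derivative_eq_rhs, rule has_vector_derivative_mult[OF d[OF der(1,2) nz(1,2)] d[OF der(3,4) nz(3,4)]])
       (simp add: algebra_simps)
  have dR: "(R has_vector_derivative R t * (m * (vfq s (x1 t) (x3 t) + vfq s (x2 t) (x4 t)))) (at t within S)"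
    unfolding R_def
    by (rule has_vector_derivative_eq_rhs, rule has_vector_derivative_mult[OF d[OF der(1,3) nz(1,3)] d[OF der(2,4) nz(2,4)]])
       (simp add: algebra_simps)
  have R0: "R t \<noteq> 0" using ne by (simp add: R_def)
  have inv: "((\<lambda>t. inverse (R t)) has_vector_derivative
      (R t * (m * (vfq s (x1 t) (x3 t) + vfq s (x2 t) (x4 t)))) * - (inverse (R t))\<^sup>2) (at t within S)"
    using field_vector_diff_chain_within[OF dR, of inverse "- (inverse (R t))\<^sup>2"] DERIV_inverse[OF R0, of "R ` S"]
    by (simp add: o_def numeral_2_eq_2)
  have "((\<lambda>t. P t * inverse (R t)) has_vector_derivative
      m * (P t / R t) * (vfq s (x1 t) (x2 t) + vfq s (x3 t) (x4 t) - vfq s (x1 t) (x3 t) - vfq s (x2 t) (x4 t)))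
      (at t within S)"
    by (rule has_vector_derivative_eq_rhs, rule has_vector_derivative_mult[OF dP inv])
       (use R0 in \<open>simp add: field_simps power2_eq_square\<close>)
  then show ?thesis
    unfolding vfq_alternating[OF nz] by (simp add: P_def R_def field_simps)
qed

text \<open>Cross ratio of the two solutions and their complex conjugates: hyperbolic
  distances grow along the flow.\<close>

lemma hyperbolic_distance_nondecreasing:
  assumes x: "sol u T x" and y: "sol u T y" and "0 \<le> T"
  shows "(cmod (x 0 - y 0))\<^sup>2 / (Im (x 0) * Im (y 0)) \<le> (cmod (x T - y T))\<^sup>2 / (Im (x T) * Im (y T))"
proof (rule nondecreasing_of_derivative_within[OF \<open>0 \<le> T\<close>,
    where f = "\<lambda>t. (cmod (x t - y t))\<^sup>2 / (Im (x t) * Im (y t))"])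
  fix t assume t: "t \<in> {0..T}"
  define q where "q t = (x t - y t) * (cnj (x t) - cnj (y t)) / ((x t - cnj (x t)) * (y t - cnj (y t)))" for t
  define c where "c = (cmod (x t - cnj (y t)))\<^sup>2 / ((cmod (num (u t) (x t)))\<^sup>2 * (cmod (num (u t) (y t)))\<^sup>2)"
  have im: "Im (x t) > 0" "Im (y t) > 0" using solD(1)[OF x t] solD(1)[OF y t] by auto
  have qt: "q t = - of_real ((cmod (x t - y t))\<^sup>2 / (4 * (Im (x t) * Im (y t))))" for t
  proof -
    have "(x t - y t) * (cnj (x t) - cnj (y t)) = of_real ((cmod (x t - y t))\<^sup>2)"
      by (metis complex_cnj_diff complex_norm_square of_real_power)
    then show ?thesis
      by (simp add: q_def complex_diff_cnj mult_ac)
  qed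
  \<comment> \<open>The coefficients are real, so the conjugates solve the same equation in the
    lower half plane, where \<open>vf\<close> has no pole either.\<close>
  have "(q has_vector_derivative 1 * q t *
     (- 2 * (x t - cnj (y t)) * (y t - cnj (x t))
        / (num (u t) (x t) * num (u t) (y t) * num (u t) (cnj (x t)) * num (u t) (cnj (y t)))))
     (at t within {0..T})"
    unfolding q_def
    using solD(2)[OF x t] solD(2)[OF y t] im num_nonzero[of "x t"] num_nonzero[of "y t"]
      num_nonzero[of "cnj (x t)"] num_nonzero[of "cnj (y t)"]
      complex_eq_iff[of "x t" "cnj (x t)"] complex_eq_iff[of "y t" "cnj (y t)"]
    by (intro cross_ratio_derivative) (auto intro!: has_vector_derivative_cnj simp flip: cnj_vf)
  \<comment> \<open>Since y - cnj x is minus the conjugate of x - cnj y, the sign turns and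
    everything pairs up into squared moduli: the logarithmic derivative is nonnegative.\<close>
  also have "- 2 * (x t - cnj (y t)) * (y t - cnj (x t))
        / (num (u t) (x t) * num (u t) (y t) * num (u t) (cnj (x t)) * num (u t) (cnj (y t)))
      = 2 * ((x t - cnj (y t)) * cnj (x t - cnj (y t)))
        / ((num (u t) (x t) * cnj (num (u t) (x t))) * (num (u t) (y t) * cnj (num (u t) (y t))))"
    by (simp add: cnj_num algebra_simps)
  also have "\<dots> = of_real (2 * c)"
    by (simp only: complex_norm_square[symmetric] c_def) simp
  finally have "((\<lambda>t. Re (q t)) has_vector_derivative Re (1 * q t * of_real (2 * c))) (at t within {0..T})"
    by (rule bounded_linear.has_vector_derivative[OF bounded_linear_Re])
  then have "((\<lambda>t. -4 * Re (q t)) has_vector_derivative -4 * Re (1 * q t * of_real (2 * c))) (at t within {0..T})"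
    by (intro derivative_intros)
  then show "((\<lambda>t. (cmod (x t - y t))\<^sup>2 / (Im (x t) * Im (y t))) has_vector_derivative
      2 * c * ((cmod (x t - y t))\<^sup>2 / (Im (x t) * Im (y t)))) (at t within {0..T})"
    by (simp add: qt mult_ac)
  show "0 \<le> 2 * c * ((cmod (x t - y t))\<^sup>2 / (Im (x t) * Im (y t)))"
    using im by (simp add: c_def)
qed

end

section \<open>Asymptotic closeness\<close>

lemma has_vector_derivative_iff_quotient:
  fixes f :: "real \<Rightarrow> complex"
  shows "(f has_vector_derivative D) (at x within S) \<longleftrightarrow>
    ((\<lambda>y. (f y - f x) / of_real (y - x)) \<longlongrightarrow> D) (at x within S)"
proof -
  have eq: "norm (f y - f x - (y - x) *\<^sub>R D) / norm (y - x) = norm ((f y - f x) / of_real (y - x) - D)"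
    if "y \<noteq> x" for y
  proof -
    have "(f y - f x) / of_real (y - x) - D = (f y - f x - (y - x) *\<^sub>R D) / of_real (y - x)"
      using that by (simp add: field_simps scaleR_conv_of_real del: of_real_diff)
    then show ?thesis by (simp add: norm_divide del: of_real_diff)
  qed
  have "(f has_vector_derivative D) (at x within S) \<longleftrightarrow>
      ((\<lambda>y. norm (f y - f x - (y - x) *\<^sub>R D) / norm (y - x)) \<longlongrightarrow> 0) (at x within S)"
    unfolding has_vector_derivative_def has_derivative_iff_norm
    by (simp add: bounded_linear_scaleR_left)
  also have "\<dots> \<longleftrightarrow> ((\<lambda>y. norm ((f y - f x) / of_real (y - x) - D)) \<longlongrightarrow> 0) (at x within S)"
    by (intro filterlim_cong refl eventually_mono[OF eventually_neq_at_within] eq)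
  also have "\<dots> \<longleftrightarrow> ((\<lambda>y. (f y - f x) / of_real (y - x)) \<longlongrightarrow> D) (at x within S)"
    by (simp only: tendsto_norm_zero_iff LIM_zero_iff)
  finally show ?thesis .
qed

text \<open>The chain rule read backwards: the increment of F along \<open>lam\<close> is a slope of
  F times the increment of \<open>lam\<close>, and the slope tends to a nonzero limit, so one can
  divide by it. Injectivity of \<open>lam\<close> is not assumed.\<close>

lemma inner_function_derivative:
  fixes F :: "real \<Rightarrow> complex" and lam :: "real \<Rightarrow> real"
  assumes F: "(F has_vector_derivative F') (at (lam t) within B)" "F' \<noteq> 0"
    and FL: "((\<lambda>s. F (lam s)) has_vector_derivative D) (at t within A)"
    and lam: "continuous (at t within A) lam" "lam ` A \<subseteq> B"
  shows "((\<lambda>s. complex_of_real (lam s)) has_vector_derivative D / F') (at t within A)"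
proof -
  \<comment> \<open>The value F' at \<open>lam t\<close> makes the slope continuous there and covers
    the times s with \<open>lam s = lam t\<close>, where the difference quotient would be
    0/0.\<close>
  define H where "H \<tau> = (if \<tau> = lam t then F' else (F \<tau> - F (lam t)) / of_real (\<tau> - lam t))" for \<tau>
  have "(H \<longlongrightarrow> F') (at (lam t) within B)"
    using F(1) unfolding has_vector_derivative_iff_quotient
    by (rule Lim_transform_eventually)
       (rule eventually_mono[OF eventually_neq_at_within[of "lam t"]], simp add: H_def)
  then have "continuous (at (lam t) within B) H"
    by (simp add: continuous_within H_def)
  then have "continuous (at t within A) (\<lambda>s. H (lam s))"
    using lam continuous_within_compose2[OF lam(1), of H] continuous_within_subset by blast
  then have HF: "((\<lambda>s. H (lam s)) \<longlongrightarrow> F') (at t within A)"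
    by (simp add: continuous_within H_def)
  have "((\<lambda>s. (F (lam s) - F (lam t)) / of_real (s - t) / H (lam s)) \<longlongrightarrow> D / F') (at t within A)"
    using FL F(2) HF unfolding has_vector_derivative_iff_quotient by (intro tendsto_divide)
  moreover have "eventually (\<lambda>s. H (lam s) \<noteq> 0) (at t within A)"
    using HF F(2) by (rule tendsto_imp_eventually_ne)
  then have "eventually (\<lambda>s. (F (lam s) - F (lam t)) / of_real (s - t) / H (lam s)
      = (of_real (lam s) - of_real (lam t)) / of_real (s - t)) (at t within A)"
    by eventually_elim (auto simp: H_def split: if_splits)
  ultimately show ?thesis
    unfolding has_vector_derivative_iff_quotient by (rule Lim_transform_eventually)
qed

text \<open>Equality up to O(E), together with a common limit. The limit supplies the local bounds
  that products need and the nonvanishing that inverses need, so closeness of composite expressions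
  follows rule by rule from their shape.\<close>

definition approx :: "'b filter \<Rightarrow> ('b \<Rightarrow> real) \<Rightarrow> ('b \<Rightarrow> 'a) \<Rightarrow> ('b \<Rightarrow> 'a) \<Rightarrow> 'a :: real_normed_field \<Rightarrow> bool"
  where "approx F E f g c \<longleftrightarrow> (f \<longlongrightarrow> c) F \<and> (g \<longlongrightarrow> c) F \<and>
    (\<exists>B. eventually (\<lambda>t. norm (f t - g t) \<le> B * E t) F)"

section \<open>Rules of calculus for closeness up to a multiple of E\<close>

lemma approxE:
  assumes "approx F E f g c"
  obtains B where "eventually (\<lambda>t. norm (f t - g t) \<le> B * E t) F"
  using assms by (auto simp: approx_def)

lemma approx_refl: "(f \<longlongrightarrow> c) F \<Longrightarrow> approx F E f f c"
  by (auto simp: approx_def intro!: exI[of _ 0])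

lemma approx_add:
  assumes "approx F E f g c" "approx F E f' g' c'"
  shows "approx F E (\<lambda>t. f t + f' t) (\<lambda>t. g t + g' t) (c + c')"
proof -
  obtain B B' where "eventually (\<lambda>t. norm (f t - g t) \<le> B * E t) F"
    "eventually (\<lambda>t. norm (f' t - g' t) \<le> B' * E t) F"
    using assms by (metis approxE)
  then have "eventually (\<lambda>t. norm (f t + f' t - (g t + g' t)) \<le> (B + B') * E t) F"
  proof eventually_elim
    case (elim t)
    have "norm (f t + f' t - (g t + g' t)) \<le> norm (f t - g t) + norm (f' t - g' t)"
      by (rule norm_diff_triangle_ineq)
    with elim show ?case by (simp add: algebra_simps)
  qed
  with assms show ?thesis
    by (auto simp: approx_def intro!: tendsto_intros)
qed

lemma approx_mult:
  assumes "approx F E f g c" "approx F E f' g' c'"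
  shows "approx F E (\<lambda>t. f t * f' t) (\<lambda>t. g t * g' t) (c * c')"
proof -
  obtain B B' where "eventually (\<lambda>t. norm (f t - g t) \<le> B * E t) F"
    "eventually (\<lambda>t. norm (f' t - g' t) \<le> B' * E t) F"
    using assms by (metis approxE)
  moreover have "((\<lambda>t. norm (f t)) \<longlongrightarrow> norm c) F" "((\<lambda>t. norm (g' t)) \<longlongrightarrow> norm c') F"
    using assms by (auto simp: approx_def intro!: tendsto_norm)
  then have "eventually (\<lambda>t. norm (f t) < norm c + 1) F" "eventually (\<lambda>t. norm (g' t) < norm c' + 1) F"
    by (auto intro: order_tendstoD)
  ultimately have "eventually (\<lambda>t. norm (f t * f' t - g t * g' t)
      \<le> ((norm c + 1) * B' + (norm c' + 1) * B) * E t) F"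
  proof eventually_elim
    case (elim t)
    have "f t * f' t - g t * g' t = f t * (f' t - g' t) + g' t * (f t - g t)"
      by (simp add: algebra_simps)
    then have "norm (f t * f' t - g t * g' t) \<le> norm (f t) * norm (f' t - g' t) + norm (g' t) * norm (f t - g t)"
      by (metis norm_mult norm_triangle_ineq)
    also have "\<dots> \<le> (norm c + 1) * (B' * E t) + (norm c' + 1) * (B * E t)"
      using elim by (intro add_mono mult_mono) auto
    finally show ?case by (simp add: algebra_simps)
  qed
  with assms show ?thesis
    by (auto simp: approx_def intro!: tendsto_intros)
qed

lemma approx_diff:
  assumes "approx F E f g c" "approx F E f' g' c'"
  shows "approx F E (\<lambda>t. f t - f' t) (\<lambda>t. g t - g' t) (c - c')"
proof -
  have "approx F E (\<lambda>t. -1 * f' t) (\<lambda>t. -1 * g' t) (-1 * c')"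
    by (intro approx_mult approx_refl assms tendsto_const)
  from approx_add[OF assms(1) this] show ?thesis by simp
qed

lemma approx_power: "approx F E f g c \<Longrightarrow> approx F E (\<lambda>t. f t ^ n) (\<lambda>t. g t ^ n) (c ^ n)"
  by (induction n) (auto intro!: approx_refl approx_mult)

lemma approx_inverse:
  assumes "approx F E f g c" "c \<noteq> 0"
  shows "approx F E (\<lambda>t. inverse (f t)) (\<lambda>t. inverse (g t)) (inverse c)"
proof -
  have lim: "(f \<longlongrightarrow> c) F" "(g \<longlongrightarrow> c) F" using assms by (auto simp: approx_def)
  then have ne: "eventually (\<lambda>t. f t \<noteq> 0) F" "eventually (\<lambda>t. g t \<noteq> 0) F"
    using assms(2) by (auto intro: tendsto_imp_eventually_ne)
  obtain B where B: "eventually (\<lambda>t. norm (f t - g t) \<le> B * E t) F"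
    using assms by (metis approxE)
  have "((\<lambda>t. norm (inverse (f t) * inverse (g t))) \<longlongrightarrow> norm (inverse c * inverse c)) F"
    using lim assms(2) by (intro tendsto_intros)
  then have "eventually (\<lambda>t. norm (inverse (f t) * inverse (g t)) < norm (inverse c * inverse c) + 1) F"
    by (rule order_tendstoD) simp
  with ne B have "eventually (\<lambda>t. norm (inverse (f t) - inverse (g t)) \<le>
      ((norm (inverse c * inverse c) + 1) * B) * E t) F"
  proof eventually_elim
    case (elim t)
    have "norm (inverse (f t) - inverse (g t)) = norm (inverse (f t) * inverse (g t)) * norm (f t - g t)"
      using elim by (simp add: inverse_diff_inverse norm_mult mult_ac norm_minus_commute)
    also have "\<dots> \<le> (norm (inverse c * inverse c) + 1) * (B * E t)"
      using elim by (intro mult_mono) auto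
    finally show ?case by (simp add: mult_ac)
  qed
  with lim assms(2) show ?thesis
    by (auto simp: approx_def intro!: tendsto_intros)
qed

lemma approx_divide:
  assumes "approx F E f g c" "approx F E f' g' c'" "c' \<noteq> 0"
  shows "approx F E (\<lambda>t. f t / f' t) (\<lambda>t. g t / g' t) (c / c')"
  unfolding divide_inverse by (intro approx_mult approx_inverse assms)

lemma approx_of_real:
  assumes "approx F E f g c"
  shows "approx F E (\<lambda>t. of_real (f t) :: complex) (\<lambda>t. of_real (g t)) (of_real c)"
  using assms by (auto simp: approx_def simp flip: of_real_diff intro!: tendsto_intros)

text \<open>Both arguments end up in the interval of radius 1 about their limit, where a continuous
  derivative is bounded and the mean value theorem gives a Lipschitz estimate.\<close>

lemma approx_compose:
  fixes f :: "real \<Rightarrow> real"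
  assumes uv: "approx F E u v c" and der: "\<And>x. (f has_real_derivative f' x) (at x)"
    and cont: "continuous_on UNIV f'"
  shows "approx F E (\<lambda>t. f (u t)) (\<lambda>t. f (v t)) (f c)"
proof -
  have lim: "(u \<longlongrightarrow> c) F" "(v \<longlongrightarrow> c) F" using uv by (auto simp: approx_def)
  have "isCont f c" using der by (rule DERIV_isCont)
  then have limf: "((\<lambda>t. f (u t)) \<longlongrightarrow> f c) F" "((\<lambda>t. f (v t)) \<longlongrightarrow> f c) F"
    using lim by (auto intro: isCont_tendsto_compose)
  have "compact (f' ` {c - 1..c + 1})"
    using cont by (intro compact_continuous_image) (auto intro: continuous_on_subset)
  then obtain M where M: "norm (f' x) \<le> M" if "x \<in> {c - 1..c + 1}" for x
    using compact_imp_bounded by (metis bounded_iff image_eqI)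
  then have "M \<ge> 0" using norm_ge_zero order_trans by (metis atLeastAtMost_iff le_add_same_cancel1 diff_le_eq zero_le_one)
  obtain B where B: "eventually (\<lambda>t. norm (u t - v t) \<le> B * E t) F"
    using uv by (metis approxE)
  have "eventually (\<lambda>t. u t \<in> {c - 1<..<c + 1}) F" "eventually (\<lambda>t. v t \<in> {c - 1<..<c + 1}) F"
    by (rule topological_tendstoD[OF lim(1)] topological_tendstoD[OF lim(2)]; simp)+
  with B have "eventually (\<lambda>t. norm (f (u t) - f (v t)) \<le> (M * B) * E t) F"
  proof eventually_elim
    case (elim t)
    have "norm (f (u t) - f (v t)) \<le> M * norm (u t - v t)"
    proof (rule field_differentiable_bound[where S = "{c - 1..c + 1}" and f' = f'])
      show "(f has_real_derivative f' z) (at z within {c - 1..c + 1})" for z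
        using der DERIV_subset by blast
    qed (use elim M in auto)
    also have "\<dots> \<le> M * (B * E t)"
      using elim \<open>M \<ge> 0\<close> by (intro mult_left_mono) auto
    finally show ?case by (simp add: mult_ac)
  qed
  with limf show ?thesis by (auto simp: approx_def)
qed

section \<open>Stability of the field, and recovery of the driving value from the pole\<close>

context loewner_coeffs
begin

lemma approx_coeffs:
  assumes "approx F E u v c"
  shows "approx F E (\<lambda>t. al (u t)) (\<lambda>t. al (v t)) (al c)" "approx F E (\<lambda>t. be (u t)) (\<lambda>t. be (v t)) (be c)"
    "approx F E (\<lambda>t. ga (u t)) (\<lambda>t. ga (v t)) (ga c)" "approx F E (\<lambda>t. de (u t)) (\<lambda>t. de (v t)) (de c)"
proof -
  have c: "continuous_on UNIV (gcosh kap)" "continuous_on UNIV (gsinh kap)"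
    using DERIV_gcosh DERIV_gsinh by (meson DERIV_isCont continuous_at_imp_continuous_on)+
  have 1: "approx F E (\<lambda>t. gcosh kap (u t)) (\<lambda>t. gcosh kap (v t)) (gcosh kap c)"
    by (rule approx_compose[OF assms DERIV_gcosh]) (intro continuous_intros c)
  have 2: "approx F E (\<lambda>t. gsinh kap (u t)) (\<lambda>t. gsinh kap (v t)) (gsinh kap c)"
    by (rule approx_compose[OF assms DERIV_gsinh]) (intro continuous_intros c)
  show "approx F E (\<lambda>t. al (u t)) (\<lambda>t. al (v t)) (al c)" "approx F E (\<lambda>t. ga (u t)) (\<lambda>t. ga (v t)) (ga c)"
    "approx F E (\<lambda>t. de (u t)) (\<lambda>t. de (v t)) (de c)"
    unfolding al_def ga_def de_def
    by (intro approx_add approx_diff approx_mult approx_refl[OF tendsto_const] 1 2)+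
  show "approx F E (\<lambda>t. be (u t)) (\<lambda>t. be (v t)) (be c)"
    using approx_diff[OF approx_refl[OF tendsto_const[of 0]] 2] by (simp add: be_def)
qed

lemma approx_num:
  "approx F E u v c \<Longrightarrow> approx F E x y w \<Longrightarrow> approx F E (\<lambda>t. num (u t) (x t)) (\<lambda>t. num (v t) (y t)) (num c w)"
  unfolding num_def by (intro approx_add approx_mult approx_of_real approx_coeffs)

lemma approx_den:
  "approx F E u v c \<Longrightarrow> approx F E x y w \<Longrightarrow> approx F E (\<lambda>t. den (u t) (x t)) (\<lambda>t. den (v t) (y t)) (den c w)"
  unfolding den_def by (intro approx_add approx_mult approx_of_real approx_coeffs)

lemma approx_vf:
  "approx F E u v c \<Longrightarrow> approx F E x y w \<Longrightarrow> num c w \<noteq> 0 \<Longrightarrow>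
    approx F E (\<lambda>t. vf (u t) (x t)) (\<lambda>t. vf (v t) (y t)) (vf c w)"
  unfolding vf_def
  by (intro approx_add approx_mult approx_divide approx_power approx_num approx_den
      approx_refl[OF tendsto_const]) auto

text \<open>The left-hand side compares the poles - be / al of vf s and vf t.\<close>

lemma pole_separation: "al s * be t - al t * be s = gsinh kap (s - t)"
  by (simp add: al_def be_def gsinh_diff algebra_simps)

text \<open>The derivative of \<open>gsinh k\<close> at 0 is 1, so the slope eventually exceeds 1/2.
  The bound is local by necessity: for negative k the function is a sine with further zeros.\<close>

lemma gsinh_lower_bound: "eventually (\<lambda>v. \<bar>v\<bar> \<le> 2 * \<bar>gsinh k v\<bar>) (nhds 0)"
proof -
  have "((\<lambda>v. gsinh k v / v) \<longlongrightarrow> 1) (at 0)"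
    using DERIV_gsinh[of k 0] by (simp add: has_field_derivative_iff)
  then have "eventually (\<lambda>v. gsinh k v / v > 1 / 2) (at 0)"
    by (rule order_tendstoD) simp
  then have "eventually (\<lambda>v. v \<noteq> 0 \<longrightarrow> gsinh k v / v > 1 / 2) (nhds 0)"
    by (simp add: eventually_at_filter)
  then show ?thesis
  proof eventually_elim
    case (elim v)
    show ?case
    proof (cases "v = 0")
      case False
      with elim have "1 / 2 < gsinh k v / v" by simp
      also have "\<dots> \<le> \<bar>gsinh k v\<bar> / \<bar>v\<bar>" by (metis abs_divide abs_ge_self)
      finally have "1 / 2 < \<bar>gsinh k v\<bar> / \<bar>v\<bar>" .
      with False have "1 / 2 * \<bar>v\<bar> < \<bar>gsinh k v\<bar>"
        by (subst (asm) pos_less_divide_eq) auto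
      then show ?thesis by simp
    qed simp
  qed
qed

end

section \<open>Local coincidence of two chains\<close>

lemma approx_sym: "approx F E f g c \<Longrightarrow> approx F E g f c"
  by (auto simp: approx_def norm_minus_commute)

context loewner_coeffs
begin

text \<open>Trajectories 0 to 3 give the rate of \<open>lam\<close>; trajectory 4 replaces 0 in a
  second formula for the same rate. The equality of the two ties the poles together, which closes a
  Gronwall system for the five differences. The cross ratio identity is assumed with denominators
  cleared, the form in which an automorphism provides it.\<close>

lemma chains_agree_locally:
  fixes x Y :: "nat \<Rightarrow> real \<Rightarrow> complex" and u ut lam :: "real \<Rightarrow> real"
  assumes T: "0 \<le> t0" "t0 < T"
    and x: "\<And>i. i < 5 \<Longrightarrow> sol u T (x i)" and Y: "\<And>i. i < 5 \<Longrightarrow> sol ut (lam T) (Y i)"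
    and u: "continuous_on {0..} u" "continuous_on {0..} ut"
    and lam: "continuous_on {0..} lam" "mono_on {0..} lam" "lam 0 = 0"
    and injx: "\<And>i j t. i < 5 \<Longrightarrow> j < 5 \<Longrightarrow> i \<noteq> j \<Longrightarrow> t \<in> {0..T} \<Longrightarrow> x i t \<noteq> x j t"
    and injY: "\<And>i j t. i < 5 \<Longrightarrow> j < 5 \<Longrightarrow> i \<noteq> j \<Longrightarrow> t \<in> {0..T} \<Longrightarrow> Y i (lam t) \<noteq> Y j (lam t)"
    and cross: "\<And>i j k l t. i < 5 \<Longrightarrow> j < 5 \<Longrightarrow> k < 5 \<Longrightarrow> l < 5 \<Longrightarrow> t \<in> {0..T} \<Longrightarrow>
       (x i t - x j t) * (x k t - x l t) * ((Y i (lam t) - Y k (lam t)) * (Y j (lam t) - Y l (lam t)))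
       = (Y i (lam t) - Y j (lam t)) * (Y k (lam t) - Y l (lam t)) * ((x i t - x k t) * (x j t - x l t))"
    and start: "\<And>i. i < 5 \<Longrightarrow> Y i (lam t0) = x i t0" "ut (lam t0) = u t0"
  shows "eventually (\<lambda>t. lam t - lam t0 = t - t0 \<and> ut (lam t) = u t) (at_right t0)"
proof -
  define y where "y i t = Y i (lam t)" for i t
  define v where "v t = ut (lam t)" for t
  \<comment> \<open>The logarithmic derivative of the cross ratio of trajectories i, j, k, l at unit
    speed, as given by \<open>cross_ratio_derivative\<close>.\<close>
  define J where "J z w i j k l t = - 2 * (z i t - z l t) * (z j t - z k t)
      / (num (w t) (z i t) * num (w t) (z j t) * num (w t) (z k t) * num (w t) (z l t))"
    for z :: "nat \<Rightarrow> real \<Rightarrow> complex" and w :: "real \<Rightarrow> real" and i j k l :: nat and t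
  define L where "L t = J x u 0 1 2 3 t / J y v 0 1 2 3 t" for t
  have lamT: "lam t \<in> {0..lam T}" if "t \<in> {0..T}" for t
    using that lam(3) mono_onD[OF lam(2), of 0 t] mono_onD[OF lam(2), of t T] by auto
  have imx: "Im (x i t) > 0" if "i < 5" "t \<in> {0..T}" for i t
    using solD(1)[OF x that(2)] that(1) by auto
  have imy: "Im (y i t) > 0" if "i < 5" "t \<in> {0..T}" for i t
    using solD(1)[OF Y lamT[OF that(2)]] that(1) by (auto simp: y_def)
  have nx: "num s (x i t) \<noteq> 0" if "i < 5" "t \<in> {0..T}" for i t s
    using imx[OF that] by (auto intro!: num_nonzero)
  have ny: "num s (y i t) \<noteq> 0" if "i < 5" "t \<in> {0..T}" for i t s
    using imy[OF that] by (auto intro!: num_nonzero)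
  have neq: "x i t \<noteq> x j t" "y i t \<noteq> y j t" if "i < 5" "j < 5" "i \<noteq> j" "t \<in> {0..T}" for i j t
    using injx[OF that] injY[OF that] by (auto simp: y_def)
  have contlam: "continuous_on {0..T} lam"
    using lam(1) by (rule continuous_on_subset) auto

  have dlam: "((\<lambda>s. complex_of_real (lam s)) has_vector_derivative
      J x u i j k l t / J y v i j k l t) (at t within {0..T})"
    if t: "t \<in> {0..T}" and ijkl: "i < 5" "j < 5" "k < 5" "l < 5"
      "i \<noteq> j" "k \<noteq> l" "i \<noteq> k" "j \<noteq> l" "i \<noteq> l" "j \<noteq> k" for i j k l t
  proof -
    define C where "C z t = (z i t - z j t) * (z k t - z l t) / ((z i t - z k t) * (z j t - z l t))"
      for z :: "nat \<Rightarrow> real \<Rightarrow> complex" and t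
    have dx: "(x i has_vector_derivative vf (u t) (x i t)) (at t within {0..T})" if "i < 5" for i
      using solD(2)[OF x[OF that] t] .
    have dY: "(Y i has_vector_derivative vf (ut (lam t)) (Y i (lam t))) (at (lam t) within {0..lam T})"
      if "i < 5" for i
      using solD(2)[OF Y[OF that] lamT[OF t]] .
    have Cx: "(C x has_vector_derivative 1 * C x t * J x u i j k l t) (at t within {0..T})"
      unfolding C_def J_def using ijkl nx[OF _ t] neq[OF _ _ _ t]
      by (intro cross_ratio_derivative) (auto intro!: dx)
    have CY: "(C Y has_vector_derivative 1 * C y t * J y v i j k l t) (at (lam t) within {0..lam T})"
      unfolding C_def J_def y_def v_def using ijkl ny[OF _ t] neq[OF _ _ _ t]
      by (intro cross_ratio_derivative) (auto intro!: dY simp: y_def)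
    have eq: "C x s = C Y (lam s)" if "s \<in> {0..T}" for s
      using cross[OF ijkl(1-4) that] neq[OF _ _ _ that] ijkl
      by (simp add: C_def y_def frac_eq_eq)
    have "((\<lambda>s. C Y (lam s)) has_vector_derivative C x t * J x u i j k l t) (at t within {0..T})"
      using has_vector_derivative_transform[OF t _ Cx, of "\<lambda>s. C Y (lam s)"] eq by simp
    \<comment> \<open>The two cross ratios are equal and nonzero, so they cancel in the quotient and
      only the logarithmic derivatives remain.\<close>
    moreover have "C y t = C x t" using eq[OF t] by (simp add: C_def y_def)
    moreover have "C x t \<noteq> 0" using ijkl neq[OF _ _ _ t] by (simp add: C_def)
    moreover have "J y v i j k l t \<noteq> 0" using ijkl neq[OF _ _ _ t] ny[OF _ t] by (simp add: J_def)
    ultimately show ?thesis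
      using inner_function_derivative[of "C Y" "1 * C y t * J y v i j k l t" lam t "{0..lam T}"
          "C x t * J x u i j k l t" "{0..T}"] CY t contlam image_subsetI[of "{0..T}" lam "{0..lam T}", OF lamT]
      by (auto simp: continuous_on_eq_continuous_within)
  qed

  have uniq: "a = b" if "(f has_vector_derivative a) (at t within {0..T})"
     "(f has_vector_derivative b) (at t within {0..T})" "t \<in> {0..T}" for f :: "real \<Rightarrow> complex" and a b t
    using vector_derivative_unique_within_closed_interval[of 0 T t f a b] that T by auto
  have dlamL: "((\<lambda>s. complex_of_real (lam s)) has_vector_derivative L t) (at t within {0..T})"
    if "t \<in> {0..T}" for t
    unfolding L_def using that by (intro dlam) auto
  \<comment> \<open>The rate is computed by complex algebra but is the derivative of a real
    function; uniqueness of derivatives shows that its imaginary part vanishes.\<close>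
  have Lreal: "L t = of_real (Re (L t))" "(lam has_vector_derivative Re (L t)) (at t within {0..T})"
    if t: "t \<in> {0..T}" for t
  proof -
    from dlamL[OF t] show d: "(lam has_vector_derivative Re (L t)) (at t within {0..T})"
      using bounded_linear.has_vector_derivative[OF bounded_linear_Re] by fastforce
    have "((\<lambda>s. complex_of_real (lam s)) has_vector_derivative of_real (Re (L t))) (at t within {0..T})"
      using bounded_linear.has_vector_derivative[OF bounded_linear_of_real d] .
    with dlamL[OF t] t show "L t = of_real (Re (L t))" by (intro uniq[of _ _ t]) auto
  qed
  \<comment> \<open>Between index lists 0,1,2,3 and 4,1,2,3 the factors of trajectories 1 and 2, and
    the numerator of 3, are common and cancel. Each side is linear in \<open>al (v t)\<close> and
    \<open>be (v t)\<close>, so the relation determines their ratio, that is, the pole.\<close>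
  have pole: "(x 0 t - x 3 t) * (y 4 t - y 3 t) * num (v t) (y 0 t) * num (u t) (x 4 t)
      = (x 4 t - x 3 t) * (y 0 t - y 3 t) * num (v t) (y 4 t) * num (u t) (x 0 t)"
    if t: "t \<in> {0..T}" for t
  proof -
    have "J x u 0 1 2 3 t / J y v 0 1 2 3 t = J x u 4 1 2 3 t / J y v 4 1 2 3 t"
      using t by (intro uniq[OF dlam dlam t]) auto
    then have "num (v t) (y 0 t) * num (u t) (x 4 t) * ((2 * x 3 t - 2 * x 0 t) * (2 * y 3 t - 2 * y 4 t))
        = num (u t) (x 0 t) * num (v t) (y 4 t) * ((2 * y 3 t - 2 * y 0 t) * (2 * x 3 t - 2 * x 4 t))"
      unfolding J_def using neq[OF _ _ _ t] nx[OF _ t] ny[OF _ t]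
      by (simp add: divide_simps mult_ac)
    then show ?thesis by algebra
  qed
  have dy: "(y i has_vector_derivative L t * vf (v t) (y i t)) (at t within {0..T})"
    if t: "t \<in> {0..T}" and i: "i < 5" for i t
  proof -
    have "(Y i has_vector_derivative vf (v t) (y i t)) (at (lam t) within lam ` {0..T})"
      using solD(2)[OF Y[OF i] lamT[OF t]] has_vector_derivative_within_subset lamT
      unfolding v_def y_def by blast
    from vector_diff_chain_within[OF Lreal(2)[OF t] this]
    have "(y i has_vector_derivative Re (L t) *\<^sub>R vf (v t) (y i t)) (at t within {0..T})"
      by (simp add: o_def y_def[abs_def])
    then show ?thesis using Lreal(1)[OF t] by (metis scaleR_conv_of_real)
  qed

  define R where "R = at_right t0"
  have R: "R = at t0 within {t0..T}" using T by (simp add: R_def at_within_Icc_at_right)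
  have evT: "eventually (\<lambda>t. t \<in> {0..T}) R"
    using T unfolding R_def by (auto intro!: eventually_at_rightI[of _ T])
  have t0: "t0 \<in> {0..T}" using T by auto
  have limR: "(f \<longlongrightarrow> f t0) R" if "continuous_on {0..T} f" for f :: "real \<Rightarrow> 'b::topological_space"
  proof -
    have "(f \<longlongrightarrow> f t0) (at t0 within {0..T})"
      using that t0 unfolding continuous_on_def by blast
    then show ?thesis
      unfolding R by (rule tendsto_within_subset) (use T in auto)
  qed
  have lims: "(u \<longlongrightarrow> u t0) R" "(v \<longlongrightarrow> u t0) R"
    "(x i \<longlongrightarrow> x i t0) R" "(y i \<longlongrightarrow> x i t0) R" if "i < 5" for i
  proof -
    show "(u \<longlongrightarrow> u t0) R" by (intro limR continuous_on_subset[OF u(1)]) auto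
    have "continuous_on {0..T} v" unfolding v_def
      using lamT by (intro continuous_on_compose2[OF u(2) contlam]) auto
    from limR[OF this] show "(v \<longlongrightarrow> u t0) R" by (simp add: v_def start)
    show "(x i \<longlongrightarrow> x i t0) R" by (intro limR sol_continuous[OF x] that)
    have "continuous_on {0..T} (y i)" unfolding y_def
      using lamT by (intro continuous_on_compose2[OF sol_continuous[OF Y[OF that]] contlam]) auto
    from limR[OF this] show "(y i \<longlongrightarrow> x i t0) R" by (simp add: y_def start that)
  qed

  define E where "E t = (\<Sum>i<5. norm (x i t - y i t))" for t
  have xy: "approx R E (x i) (y i) (x i t0)" if "i < 5" for i
  proof -
    have "norm (x i t - y i t) \<le> 1 * E t" for t
      unfolding E_def using that member_le_sum[of i "{..<5}" "\<lambda>i. norm (x i t - y i t)"] by simp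
    then show ?thesis using lims[OF that] by (auto simp: approx_def intro: exI[of _ 1])
  qed
  have uu: "approx R E u u (u t0)" and vv: "approx R E v v (u t0)"
    using lims[of 0] by (auto intro: approx_refl)
  have xx: "approx R E (x i) (x i) (x i t0)" if "i < 5" for i
    using lims[OF that] by (intro approx_refl)

  have uv: "approx R E v u (u t0)"
  proof -
    have vt0: "v t0 = u t0" by (simp add: v_def start)
    \<comment> \<open>The two sides of \<open>pole\<close>, with the slots of the second chain left
      open. Filled with y they agree; filled with x they differ by exactly \<open>q t\<close> times
      \<open>gsinh kap (v t - u t)\<close>. As y and x differ by at most E, this product is
      O(E).\<close>
    define f g where "f z t = (x 0 t - x 3 t) * (z 4 t - z 3 t) * num (v t) (z 0 t) * num (u t) (x 4 t)"
      and "g z t = (x 4 t - x 3 t) * (z 0 t - z 3 t) * num (v t) (z 4 t) * num (u t) (x 0 t)"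
      for z :: "nat \<Rightarrow> real \<Rightarrow> complex" and t
    define q where "q t = (x 0 t - x 3 t) * (x 4 t - x 3 t) * (x 0 t - x 4 t)" for t
    have fg: "f x t - g x t = q t * of_real (gsinh kap (v t - u t))" for t
      unfolding pole_separation[symmetric] by (simp add: f_def g_def q_def num_def algebra_simps)
    have "approx R E (f x) (f y) (f x t0)" "approx R E (g x) (g y) (g x t0)"
      unfolding f_def[abs_def] g_def[abs_def] vt0
      by (intro approx_mult approx_diff approx_num xx xy uu vv; simp)+
    then obtain B B' where B: "eventually (\<lambda>t. norm (f x t - f y t) \<le> B * E t) R"
        "eventually (\<lambda>t. norm (g x t - g y t) \<le> B' * E t) R"
      by (metis approxE)
    have q0: "q t0 \<noteq> 0" using neq[OF _ _ _ t0] by (simp add: q_def)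
    have "((\<lambda>t. norm (q t)) \<longlongrightarrow> norm (q t0)) R"
      unfolding q_def by (intro tendsto_intros lims) auto
    \<comment> \<open>A lower bound away from 0 for the factor in front of \<open>gsinh\<close>,
      valid because \<open>q\<close> has a nonzero limit.\<close>
    then have q: "eventually (\<lambda>t. norm (q t0) / 2 < norm (q t)) R"
      by (rule order_tendstoD) (use q0 in auto)
    have "((\<lambda>t. v t - u t) \<longlongrightarrow> u t0 - u t0) R"
      using lims[of 0] by (intro tendsto_diff) auto
    then have "eventually (\<lambda>t. \<bar>v t - u t\<bar> \<le> 2 * \<bar>gsinh kap (v t - u t)\<bar>) R"
      using eventually_compose_filterlim[OF gsinh_lower_bound] by fastforce
    with B q evT have "eventually (\<lambda>t. norm (v t - u t) \<le> (2 * (2 * (B + B') / norm (q t0))) * E t) R"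
    proof eventually_elim
      case (elim t)
      have "norm (q t0) / 2 * \<bar>gsinh kap (v t - u t)\<bar> \<le> norm (q t) * \<bar>gsinh kap (v t - u t)\<bar>"
        using elim by (intro mult_right_mono) auto
      also have "\<dots> = norm (f x t - g x t)"
        by (simp add: fg norm_mult)
      also have "f x t - g x t = (f x t - f y t) - (g x t - g y t)"
        using pole elim by (simp add: f_def g_def)
      also have "norm \<dots> \<le> B * E t + B' * E t"
        using norm_triangle_ineq4[of "f x t - f y t" "g x t - g y t"] elim by linarith
      finally have "\<bar>gsinh kap (v t - u t)\<bar> \<le> 2 * (B + B') / norm (q t0) * E t"
        using q0 by (simp add: field_simps)
      moreover have "\<bar>v t - u t\<bar> \<le> 2 * \<bar>gsinh kap (v t - u t)\<bar>"
        using elim by simp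
      ultimately have "\<bar>v t - u t\<bar> \<le> 2 * (2 * (B + B') / norm (q t0) * E t)"
        by linarith
      then show ?case by (simp only: real_norm_def mult.assoc)
    qed
    then show ?thesis unfolding approx_def using lims(1,2)[of 0, simplified] by blast
  qed
  then have uv: "approx R E u v (u t0)" by (rule approx_sym)

  have Jxy: "approx R E (\<lambda>t. J x u 0 1 2 3 t) (\<lambda>t. J y v 0 1 2 3 t) (J x u 0 1 2 3 t0)"
    unfolding J_def using nx[OF _ t0]
    by (intro approx_mult approx_divide approx_diff approx_num uv xy approx_refl[OF tendsto_const]) auto
  have J0: "J x u 0 1 2 3 t \<noteq> 0" "J y v 0 1 2 3 t \<noteq> 0" if "t \<in> {0..T}" for t
    using neq[OF _ _ _ that] nx[OF _ that] ny[OF _ that] by (auto simp: J_def)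
  \<comment> \<open>The constant 1 is written as a quotient with the denominator of
    \<open>L\<close>, so that it is compared with \<open>L\<close> through the numerators
    alone.\<close>
  have L1: "approx R E (\<lambda>t. J y v 0 1 2 3 t / J y v 0 1 2 3 t) L 1"
  proof -
    have "approx R E (\<lambda>t. J y v 0 1 2 3 t / J y v 0 1 2 3 t) L (J x u 0 1 2 3 t0 / J x u 0 1 2 3 t0)"
      unfolding L_def using Jxy J0[OF t0]
      by (intro approx_divide approx_sym[OF Jxy] approx_refl) (auto simp: approx_def)
    then show ?thesis using J0[OF t0] by simp
  qed
  have "\<exists>B. eventually (\<lambda>t. norm (vf (u t) (x i t) - L t * vf (v t) (y i t)) \<le> B * E t) R" if "i < 5" for i
  proof -
    have "approx R E (\<lambda>t. (J y v 0 1 2 3 t / J y v 0 1 2 3 t) * vf (u t) (x i t)) (\<lambda>t. L t * vf (v t) (y i t))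
        (1 * vf (u t0) (x i t0))"
      using that nx[OF that t0] by (intro approx_mult L1 approx_vf uv xy) auto
    then obtain B where "eventually (\<lambda>t. norm ((J y v 0 1 2 3 t / J y v 0 1 2 3 t) * vf (u t) (x i t)
        - L t * vf (v t) (y i t)) \<le> B * E t) R"
      by (rule approxE)
    with evT have "eventually (\<lambda>t. norm (vf (u t) (x i t) - L t * vf (v t) (y i t)) \<le> B * E t) R"
      by eventually_elim (use J0 in simp)
    then show ?thesis by blast
  qed
  then obtain B where B: "eventually (\<lambda>t. norm (vf (u t) (x i t) - L t * vf (v t) (y i t)) \<le> B i * E t) R"
    if "i < 5" for i by metis
  obtain B1 where B1: "eventually (\<lambda>t. norm (J y v 0 1 2 3 t / J y v 0 1 2 3 t - L t) \<le> B1 * E t) R"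
    using L1 by (rule approxE)
  obtain B2 where B2: "eventually (\<lambda>t. norm (u t - v t) \<le> B2 * E t) R"
    using uv by (rule approxE)
  have "eventually (\<lambda>t. \<forall>i\<in>{..<5}. norm (vf (u t) (x i t) - L t * vf (v t) (y i t)) \<le> B i * E t) R"
    using B by (intro eventually_ball_finite) auto
  with B1 B2 evT have "eventually (\<lambda>t. t \<in> {0..T} \<and>
      (\<forall>i<5. norm (vf (u t) (x i t) - L t * vf (v t) (y i t)) \<le> B i * E t) \<and>
      norm (1 - L t) \<le> B1 * E t \<and> norm (u t - v t) \<le> B2 * E t) R"
    by eventually_elim (use J0 in auto)
  then obtain b where b: "b > t0" and near: "\<And>t. t0 < t \<Longrightarrow> t < b \<Longrightarrow> t \<in> {0..T} \<and>
      (\<forall>i<5. norm (vf (u t) (x i t) - L t * vf (v t) (y i t)) \<le> B i * E t) \<and>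
      norm (1 - L t) \<le> B1 * E t \<and> norm (u t - v t) \<le> B2 * E t"
    unfolding R_def by (auto simp: eventually_at_right_field)
  have at0: "x i t0 = y i t0" if "i < 5" for i
    using start that by (auto simp: y_def)
  have vt0: "v t0 = u t0" by (simp add: v_def start)
  \<comment> \<open>The estimates hold strictly to the right of \<open>t0\<close>, whereas Gronwall
    also asks for the endpoint; there both sides are evaluated exactly.\<close>
  have "J x u 0 1 2 3 t0 = J y v 0 1 2 3 t0"
    using at0 by (simp add: J_def vt0)
  then have L0: "L t0 = 1" using J0[OF t0] by (simp add: L_def)
  have agree: "lam c - lam t0 = c - t0 \<and> ut (lam c) = u c" if c: "t0 < c" "c < b" for c
  proof -
    have sub: "{t0..c} \<subseteq> {0..T}"
      using near[OF c] T by auto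
    have zero: "x i t - y i t = 0" if "i < 5" "t \<in> {t0..c}" for i t
    proof (rule gronwall_zero_family[where f = "\<lambda>i t. x i t - y i t" and I = "{..<5}"
          and C = "\<Sum>i<5. \<bar>B i\<bar>" and a = t0 and b = c
          and f' = "\<lambda>i t. vf (u t) (x i t) - L t * vf (v t) (y i t)"])
      fix i :: nat and t assume i: "i \<in> {..<5}" and t: "t \<in> {t0..c}"
      then have tT: "t \<in> {0..T}" and i5: "i < 5" using sub by auto
      show "((\<lambda>t. x i t - y i t) has_vector_derivative vf (u t) (x i t) - L t * vf (v t) (y i t))
          (at t within {t0..c})"
        by (rule has_vector_derivative_within_subset[OF _ sub])
           (intro derivative_intros solD(2)[OF x] dy tT i5)
      have "E t \<ge> 0" by (simp add: E_def sum_nonneg)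
      show "norm (vf (u t) (x i t) - L t * vf (v t) (y i t)) \<le> (\<Sum>i<5. \<bar>B i\<bar>) * (\<Sum>j<5. norm (x j t - y j t))"
      proof (cases "t = t0")
        case True
        then show ?thesis using at0[OF i5] L0 vt0 by (simp add: sum_nonneg)
      next
        case False
        with t c near[of t] i5 have "norm (vf (u t) (x i t) - L t * vf (v t) (y i t)) \<le> B i * E t"
          by auto
        also have "B i \<le> \<bar>B i\<bar>" by simp
        also have "\<bar>B i\<bar> \<le> (\<Sum>i<5. \<bar>B i\<bar>)"
          using i member_le_sum[of i "{..<5}" "\<lambda>i. \<bar>B i\<bar>"] by simp
        finally show ?thesis unfolding E_def using \<open>E t \<ge> 0\<close>
          by (simp add: mult_right_mono E_def)
      qed
    qed (use at0 that in auto)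
    have E0: "E t = 0" if "t \<in> {t0..c}" for t
      using zero that by (simp add: E_def)
    have L1: "L t = 1" if "t \<in> {t0..c}" for t
      using near[of t] E0[OF that] L0 that c by (cases "t = t0") auto
    \<comment> \<open>With E = 0 the bound on \<open>1 - L\<close> forces rate 1 on the whole
      interval.\<close>
    have "lam c - lam t0 - (c - t0) = 0"
    proof (rule gronwall_zero[where f = "\<lambda>t. lam t - lam t0 - (t - t0)" and a = t0 and b = c and C = 0])
      fix t assume t: "t \<in> {t0..c}"
      then have "t \<in> {0..T}" using sub by auto
      from has_vector_derivative_within_subset[OF Lreal(2)[OF this] sub]
      show "((\<lambda>t. lam t - lam t0 - (t - t0)) has_vector_derivative 0) (at t within {t0..c})"
        unfolding has_real_derivative_iff_has_vector_derivative[symmetric] L1[OF t]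
        by (auto intro!: derivative_eq_intros)
    qed (use c in auto)
    moreover have "u c = v c"
      using near[OF c] E0[of c] c by auto
    ultimately show ?thesis by (simp add: v_def)
  qed
  then show ?thesis
    using b unfolding eventually_at_right_field by blast
qed

end

section \<open>Automorphisms of the half plane\<close>

lemma open_upper_half: "open upper_half"
  by (simp add: upper_half_def open_halfspace_Im_gt)

section \<open>Cayley transforms and the Schwarz lemma\<close>

lemma cayley_in_ball:
  assumes "Im v > 0" "Im z > 0"
  shows "cmod ((z - v) / (z - cnj v)) < 1"
proof -
  have "(cmod (z - v))\<^sup>2 < (cmod (z - cnj v))\<^sup>2"
    unfolding cmod_power2 using mult_pos_pos[OF assms] by (simp add: power2_eq_square algebra_simps)
  then have "cmod (z - v) < cmod (z - cnj v)"
    by (rule power2_less_imp_less) simp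
  then show ?thesis
    by (simp add: norm_divide divide_simps)
qed

text \<open>Up to the positive factor |1 - w|^2 in the denominator, the imaginary part of the
  preimage is Im v times 1 - |w|^2.\<close>

lemma cayley_inverse:
  assumes v: "Im v > 0" and w: "cmod w < 1"
  defines "z \<equiv> (v - cnj v * w) / (1 - w)"
  shows "Im z > 0" "(z - v) / (z - cnj v) = w"
proof -
  have w1: "1 - w \<noteq> 0" using w by auto
  have v0: "v - cnj v \<noteq> 0" using v by (auto simp: complex_eq_iff)
  have w2: "(cmod w)\<^sup>2 < 1" using w by (simp add: power_less_one_iff abs_square_less_1)
  have "z = (v - cnj v * w) * cnj (1 - w) / of_real ((cmod (1 - w))\<^sup>2)"
    unfolding z_def complex_norm_square
    by (rule nonzero_mult_divide_mult_cancel_right[symmetric]) (use w1 complex_cnj_zero_iff[of "1 - w"] in simp)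
  also have "Im \<dots> = Im ((v - cnj v * w) * cnj (1 - w)) / (cmod (1 - w))\<^sup>2"
    by (rule Im_divide_of_real)
  also have "Im ((v - cnj v * w) * cnj (1 - w)) = Im v * (1 - (cmod w)\<^sup>2)"
    unfolding cmod_power2 by (simp add: power2_eq_square algebra_simps)
  finally show "Im z > 0"
    using v w1 w2 by (simp add: zero_less_divide_iff)
  have "z - v = (v - cnj v) * w / (1 - w)" "z - cnj v = (v - cnj v) / (1 - w)"
    unfolding z_def using w1 by (simp_all add: field_simps)
  then show "(z - v) / (z - cnj v) = w"
    using v0 w1 by simp
qed

lemma cayley_left_inverse:
  assumes "Im v > 0" "Im z > 0"
  defines "q \<equiv> (z - v) / (z - cnj v)"
  shows "(v - cnj v * q) / (1 - q) = z"
proof -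
  have ne: "z - cnj v \<noteq> 0" "v - cnj v \<noteq> 0"
    using assms by (auto simp: complex_eq_iff)
  then have "1 - q = (v - cnj v) / (z - cnj v)" "v - cnj v * q = z * (v - cnj v) / (z - cnj v)"
    by (simp_all add: q_def field_simps)
  then show ?thesis using ne by simp
qed

text \<open>The Cayley transform on the source side is centred at v and the one on the target side
  at f v, so the conjugated map fixes 0 and maps the disc into itself.\<close>

lemma cayley_schwarz:
  assumes f: "f holomorphic_on upper_half" "f ` upper_half \<subseteq> upper_half"
    and v: "v \<in> upper_half"
  defines "F \<equiv> \<lambda>w. (f ((v - cnj v * w) / (1 - w)) - f v) / (f ((v - cnj v * w) / (1 - w)) - cnj (f v))"
  shows "F holomorphic_on ball 0 1" "F 0 = 0" "\<And>w. cmod w < 1 \<Longrightarrow> cmod (F w) < 1"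
    "\<And>w. cmod w < 1 \<Longrightarrow> cmod (F w) \<le> cmod w"
proof -
  define T where "T w = (v - cnj v * w) / (1 - w)" for w
  have T: "T w \<in> upper_half" if "cmod w < 1" for w
    using cayley_inverse(1)[of v w] that v by (simp add: T_def upper_half_def)
  have Im: "Im (f (T w)) > 0" "Im (f v) > 0" if "cmod w < 1" for w
    using f(2) T[OF that] v by (auto simp: upper_half_def)
  have "T holomorphic_on ball 0 1"
    unfolding T_def by (intro holomorphic_intros) auto
  then have fT: "(\<lambda>w. f (T w)) holomorphic_on ball 0 1"
    using holomorphic_on_compose_gen[OF _ f(1), of T "ball 0 1"] T image_subsetI[of "ball 0 1" T upper_half]
    by (simp add: o_def)
  have "f (T w) \<noteq> cnj (f v)" if "cmod w < 1" for w
    using Im[OF that] by (auto simp: complex_eq_iff)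
  then show hol: "F holomorphic_on ball 0 1"
    unfolding F_def T_def[symmetric] by (intro holomorphic_intros fT) auto
  show F0: "F 0 = 0" by (simp add: F_def)
  have lt: "cmod (F w) < 1" if "cmod w < 1" for w
    unfolding F_def T_def[symmetric] using Im[OF that] by (intro cayley_in_ball)
  then show "\<And>w. cmod w < 1 \<Longrightarrow> cmod (F w) < 1" .
  show "\<And>w. cmod w < 1 \<Longrightarrow> cmod (F w) \<le> cmod w"
    using Schwarz_Lemma(1)[OF hol F0 lt] .
qed

text \<open>By the Schwarz lemma, f is conjugate to a rotation of the disc; hence the factorised difference.\<close>

lemma upper_half_automorphism_difference:
  assumes f: "f holomorphic_on upper_half" "bij_betw f upper_half upper_half"
  obtains c k where "\<And>x y. x \<in> upper_half \<Longrightarrow> y \<in> upper_half \<Longrightarrow> f x - f y = c * k x * k y * (x - y)"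
proof -
  have inj: "inj_on f upper_half" and im: "f ` upper_half = upper_half"
    using f(2) by (auto simp: bij_betw_def)
  obtain g where g: "g holomorphic_on upper_half" "\<And>z. z \<in> upper_half \<Longrightarrow> g (f z) = z"
    using holomorphic_has_inverse[OF f(1) open_upper_half inj] im by metis
  have gim: "g ` upper_half \<subseteq> upper_half"
    by (metis g(2) im image_iff image_subsetI)
  define v where "v = f \<i>"
  have i: "\<i> \<in> upper_half" by (simp add: upper_half_def)
  have v: "v \<in> upper_half" using im i by (auto simp: v_def)
  have gv: "g v = \<i>" by (simp add: v_def g(2) i)
  define F where "F w = (f ((\<i> - cnj \<i> * w) / (1 - w)) - v) / (f ((\<i> - cnj \<i> * w) / (1 - w)) - cnj v)" for w
  have F: "F holomorphic_on ball 0 1" "F 0 = 0" "\<And>w. cmod w < 1 \<Longrightarrow> cmod (F w) < 1"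
    "\<And>w. cmod w < 1 \<Longrightarrow> cmod (F w) \<le> cmod w"
    unfolding F_def[abs_def] v_def
    by (intro cayley_schwarz[OF f(1) equalityD1[OF im] i]; assumption)+
  have FT: "F ((z - \<i>) / (z - cnj \<i>)) = (f z - v) / (f z - cnj v)" if "z \<in> upper_half" for z
    using cayley_left_inverse[of \<i> z] that by (simp only: F_def) (simp add: upper_half_def)
  \<comment> \<open>The Schwarz lemma for the inverse map, centred at v = f(i), gives the opposite
    inequality.\<close>
  have ge: "cmod w \<le> cmod (F w)" if w: "cmod w < 1" for w
  proof -
    define z where "z = (\<i> - cnj \<i> * w) / (1 - w)"
    have z: "z \<in> upper_half" "(z - \<i>) / (z - cnj \<i>) = w"
      using cayley_inverse[of \<i> w] w by (auto simp: z_def upper_half_def)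
    define q where "q = (f z - v) / (f z - cnj v)"
    have q: "F w = q" using FT[OF z(1)] z(2) by (simp add: q_def)
    have "cmod q < 1" using F(3)[OF w] q by simp
    have fz: "f z \<in> upper_half" using im z(1) by auto
    then have "(v - cnj v * q) / (1 - q) = f z"
      using cayley_left_inverse[of v "f z"] v by (simp add: q_def upper_half_def)
    with cayley_schwarz(4)[OF g(1) gim v \<open>cmod q < 1\<close>]
    have "cmod ((z - \<i>) / (z - cnj \<i>)) \<le> cmod q"
      by (simp only: gv g(2)[OF z(1)])
    then show ?thesis using z(2) q by simp
  qed
  \<comment> \<open>Equality at one nonzero point already forces F to be linear; 1/2 is an arbitrary
    choice.\<close>
  have "cmod (F (1/2)) = cmod (1/2)"
    by (intro antisym F(4) ge) (simp_all add: norm_divide)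
  then have "\<exists>z. cmod z < 1 \<and> z \<noteq> 0 \<and> cmod (F z) = cmod z"
    by (intro exI[of _ "1/2"]) (simp add: norm_divide)
  moreover have "cmod 0 < 1" by simp
  ultimately obtain \<alpha> where \<alpha>: "\<And>w. cmod w < 1 \<Longrightarrow> F w = \<alpha> * w"
    using Schwarz_Lemma(3)[OF F(1-3)] by blast
  \<comment> \<open>A difference of two values of (z - p) / (z - q) equals (p - q) (a - b) / ((a -
    q) (b - q)). Applied on both sides of F w = \<alpha> w, this leaves one factor per point, namely
    \<open>k\<close>, and a constant.\<close>
  define k where "k z = (f z - cnj v) / (z - cnj \<i>)" for z
  define c where "c = \<alpha> * (\<i> - cnj \<i>) / (v - cnj v)"
  have "f x - f y = c * k x * k y * (x - y)" if x: "x \<in> upper_half" and y: "y \<in> upper_half" for x y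
  proof -
    have ne: "x - cnj \<i> \<noteq> 0" "y - cnj \<i> \<noteq> 0" "f x - cnj v \<noteq> 0" "f y - cnj v \<noteq> 0" "v - cnj v \<noteq> 0"
      using x y v imageI[OF x, of f] imageI[OF y, of f]
      unfolding im by (auto simp: upper_half_def complex_eq_iff)
    have T: "(f z - v) / (f z - cnj v) = \<alpha> * ((z - \<i>) / (z - cnj \<i>))" if "z \<in> upper_half" for z
      using FT[OF that] \<alpha>[OF cayley_in_ball[of \<i> z]] that by (simp add: upper_half_def)
    have diff: "(a - p) / (a - q) - (b - p) / (b - q) = (p - q) * (a - b) / ((a - q) * (b - q))"
      if "a - q \<noteq> 0" "b - q \<noteq> 0" for a b p q :: complex
      using that by (simp add: divide_simps) (simp add: algebra_simps)
    have "(v - cnj v) * (f x - f y) / ((f x - cnj v) * (f y - cnj v))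
        = \<alpha> * ((\<i> - cnj \<i>) * (x - y) / ((x - cnj \<i>) * (y - cnj \<i>)))"
      using T[OF x] T[OF y] diff[OF ne(3,4), of v] diff[OF ne(1,2), of \<i>]
      by (metis right_diff_distrib)
    then show ?thesis
      using ne by (simp add: c_def k_def divide_simps) (simp add: algebra_simps)
  qed
  then show ?thesis by (rule that)
qed

text \<open>Each of the four points occurs exactly once in either product of differences, so both
  sides pick up the same factors from the factorised difference. With denominators cleared,
  coinciding points cause no exception.\<close>

lemma upper_half_automorphism_cross_ratio:
  assumes "f holomorphic_on upper_half" "bij_betw f upper_half upper_half"
    and "a \<in> upper_half" "b \<in> upper_half" "c \<in> upper_half" "d \<in> upper_half"
  shows "(a - b) * (c - d) * ((f a - f c) * (f b - f d)) = (f a - f b) * (f c - f d) * ((a - c) * (b - d))"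
proof -
  obtain e k where "\<And>x y. x \<in> upper_half \<Longrightarrow> y \<in> upper_half \<Longrightarrow> f x - f y = e * k x * k y * (x - y)"
    using upper_half_automorphism_difference[OF assms(1,2)] by blast
  with assms(3-6) show ?thesis by (simp add: mult_ac)
qed

section \<open>Transfer to the domain\<close>

locale loewner_setting = loewner_coeffs +
  fixes D :: "complex set" and \<phi> :: "complex \<Rightarrow> complex" and h :: "real \<Rightarrow> complex \<Rightarrow> complex"
  assumes open_D: "open D" and hol: "\<phi> holomorphic_on upper_half"
    and bij: "bij_betw \<phi> upper_half D" and flow: "aut_flow D (loewner_sigma \<phi> s0 s1) h"
begin

definition \<psi> :: "complex \<Rightarrow> complex" where "\<psi> = inv_into upper_half \<phi>"

abbreviation b :: "complex \<Rightarrow> complex" where "b \<equiv> loewner_b \<phi> bm1 b0 b1"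

abbreviation dom :: "(real \<Rightarrow> real) \<Rightarrow> real \<Rightarrow> complex set" where "dom \<equiv> loewner_dom D b h"

lemma \<psi>: "w \<in> D \<Longrightarrow> \<psi> w \<in> upper_half" "w \<in> D \<Longrightarrow> \<phi> (\<psi> w) = w" "z \<in> upper_half \<Longrightarrow> \<psi> (\<phi> z) = z"
  "z \<in> upper_half \<Longrightarrow> \<phi> z \<in> D"
  using bij by (auto simp: \<psi>_def bij_betw_def inv_into_into f_inv_into_f)

lemma bij_\<psi>: "bij_betw \<psi> D upper_half"
  using bij unfolding \<psi>_def by (rule bij_betw_inv_into)

lemma \<psi>_eq_iff: "z \<in> D \<Longrightarrow> w \<in> D \<Longrightarrow> \<psi> z = \<psi> w \<longleftrightarrow> z = w"
  using \<psi>(2) by metis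

lemma Im_\<psi>: "w \<in> D \<Longrightarrow> Im (\<psi> w) > 0"
  using \<psi>(1) by (auto simp: upper_half_def)

lemma hol_\<psi>: "\<psi> holomorphic_on D" and deriv_\<psi>: "w \<in> D \<Longrightarrow> deriv \<phi> (\<psi> w) * deriv \<psi> w = 1"
proof -
  have inj: "inj_on \<phi> upper_half" and im: "\<phi> ` upper_half = D"
    using bij by (auto simp: bij_betw_def)
  obtain g where g: "g holomorphic_on D" "\<And>z. z \<in> upper_half \<Longrightarrow> deriv \<phi> z * deriv g (\<phi> z) = 1"
    "\<And>z. z \<in> upper_half \<Longrightarrow> g (\<phi> z) = z"
    using holomorphic_has_inverse[OF hol open_upper_half inj] unfolding im by metis
  have eq: "g w = \<psi> w" if "w \<in> D" for w
    using g(3)[of "\<psi> w"] \<psi>[of w] that by simp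
  show "\<psi> holomorphic_on D"
    using holomorphic_transform[OF g(1) eq] .
  assume w: "w \<in> D"
  have "deriv \<psi> w = deriv g w"
    by (rule deriv_cong_ev[OF eventually_mono[OF eventually_nhds_in_open[OF open_D w]] refl]) (simp add: eq)
  then show "deriv \<phi> (\<psi> w) * deriv \<psi> w = 1"
    using g(2)[OF \<psi>(1)[OF w]] \<psi>(2)[OF w] by simp
qed

lemma DERIV_\<phi>: "z \<in> upper_half \<Longrightarrow> (\<phi> has_field_derivative deriv \<phi> z) (at z)"
  by (rule holomorphic_derivI[OF hol open_upper_half])

lemma DERIV_\<psi>: "w \<in> D \<Longrightarrow> (\<psi> has_field_derivative deriv \<psi> w) (at w)"
  by (rule holomorphic_derivI[OF hol_\<psi> open_D])

lemma \<psi>_chain: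
  assumes "(\<gamma> has_vector_derivative v) (at t within S)" "\<gamma> t \<in> D"
  shows "((\<lambda>s. \<psi> (\<gamma> s)) has_vector_derivative v * deriv \<psi> (\<gamma> t)) (at t within S)"
  using field_vector_diff_chain_within[OF assms(1) has_field_derivative_at_within[OF DERIV_\<psi>[OF assms(2)]]]
  by (simp add: o_def)

lemma ell_eq: "w \<in> D \<Longrightarrow> ell \<phi> n w = deriv \<phi> (\<psi> w) * ellH n (\<psi> w)"
  by (simp add: ell_def pushfwd_def \<psi>_def)

lemma loewner_sigma_eq:
  assumes "w \<in> D"
  shows "loewner_sigma \<phi> s0 s1 w = - deriv \<phi> (\<psi> w) * (1 + of_real s0 * \<psi> w + of_real s1 * (\<psi> w)\<^sup>2)"
  using assms unfolding loewner_sigma_def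
  by (simp add: ell_eq ellH_def algebra_simps power_int_def nat_numeral)

lemma loewner_b_eq:
  assumes "w \<in> D"
  shows "b w = - deriv \<phi> (\<psi> w) *
    (2 / \<psi> w + of_real bm1 + of_real b0 * \<psi> w + of_real b1 * (\<psi> w)\<^sup>2)"
  using assms unfolding loewner_b_def
  by (simp add: ell_eq ellH_def algebra_simps power_int_def nat_numeral divide_inverse)

text \<open>The inverse Moebius map at time r, applied to the moving point, is shown to be constant;
  no uniqueness theorem for the flow is invoked.\<close>

lemma flow_eq_moebius:
  assumes w: "w \<in> D"
  shows "\<psi> (h s w) = num s (\<psi> w) / den s (\<psi> w)"
proof -
  define Z where "Z r = \<psi> (h r w)" for r
  have hD: "h r w \<in> D" for r using flow w by (auto simp: aut_flow_def)
  have ImZ: "Im (Z r) > 0" for r using Im_\<psi>[OF hD] by (simp add: Z_def)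
  have dZ: "(Z has_vector_derivative - (1 + of_real s0 * Z r + of_real s1 * (Z r)\<^sup>2)) (at r)" for r
  proof -
    have "((\<lambda>r. h r w) has_vector_derivative loewner_sigma \<phi> s0 s1 (h r w)) (at r)"
      using flow w by (auto simp: aut_flow_def)
    note \<psi>_chain[OF this hD]
    moreover have "loewner_sigma \<phi> s0 s1 (h r w) * deriv \<psi> (h r w)
        = - (1 + of_real s0 * Z r + of_real s1 * (Z r)\<^sup>2)"
      unfolding loewner_sigma_eq[OF hD] Z_def using deriv_\<psi>[OF hD[of r]] by algebra
    ultimately show ?thesis by (simp add: Z_def[abs_def])
  qed
  define c q where "c r = complex_of_real (gcosh kap r)" and "q r = complex_of_real (gsinh kap r)" for r
  have dc: "(c has_vector_derivative of_real (kap * gsinh kap r)) (at r)"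
    and dq: "(q has_vector_derivative of_real (gcosh kap r)) (at r)" for r
    unfolding c_def[abs_def] q_def[abs_def]
    by (intro has_vector_derivative_of_real DERIV_gcosh DERIV_gsinh)+
  \<comment> \<open>Numerator and denominator of the inverse matrix, with rows (de, -be) and (-ga,
    al), applied to \<open>Z r\<close>. Both satisfy the linear equation y' = -\<mu> y, so their
    quotient has derivative 0.\<close>
  define N M where "N r = (c r + of_real (s0 / 2) * q r) * Z r + q r"
    and "M r = c r - of_real (s0 / 2) * q r - of_real s1 * q r * Z r" for r
  have M: "M r \<noteq> 0" for r
  proof
    assume "M r = 0"
    then have "complex_of_real (al r) - of_real (ga r) * Z r = 0"
      by (simp add: M_def c_def q_def al_def ga_def)
    with ImZ[of r] det[of r] show False
      by (auto simp: complex_eq_iff)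
  qed
  define K S0 where "K = complex_of_real kap" and "S0 = complex_of_real (s0 / 2)"
  have K: "K = S0\<^sup>2 - of_real s1"
    by (simp add: K_def S0_def kap_def power_divide)
  define \<mu> where "\<mu> r = S0 + of_real s1 * Z r" for r
  have dN: "(N has_vector_derivative - \<mu> r * N r) (at r)" for r
  proof -
    have "(N has_vector_derivative (c r + S0 * q r) * - (1 + of_real s0 * Z r + of_real s1 * (Z r)\<^sup>2)
        + (K * q r + S0 * c r) * Z r + c r) (at r)"
      unfolding N_def[abs_def] S0_def[symmetric]
      by (rule has_vector_derivative_eq_rhs) (rule derivative_intros dc dq dZ refl | simp add: K_def c_def q_def)+
    moreover have "complex_of_real s0 = 2 * S0" by (simp add: S0_def)
    ultimately show ?thesis
      by (simp add: N_def \<mu>_def K S0_def[symmetric]) (simp add: algebra_simps power2_eq_square)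
  qed
  have dM: "(M has_vector_derivative - \<mu> r * M r) (at r)" for r
  proof -
    have "(M has_vector_derivative K * q r - S0 * c r - of_real s1 * (c r * Z r
        + q r * - (1 + of_real s0 * Z r + of_real s1 * (Z r)\<^sup>2))) (at r)"
      unfolding M_def[abs_def] S0_def[symmetric] mult.assoc
      by (rule has_vector_derivative_eq_rhs) (rule derivative_intros dc dq dZ refl | simp add: K_def c_def q_def)+
    moreover have "complex_of_real s0 = 2 * S0" by (simp add: S0_def)
    ultimately show ?thesis
      by (simp add: M_def \<mu>_def K S0_def[symmetric]) (simp add: algebra_simps power2_eq_square)
  qed
  have "((\<lambda>r. N r * inverse (M r)) has_vector_derivative 0) (at r within UNIV)" for r
  proof -
    have "((\<lambda>r. inverse (M r)) has_vector_derivative (- \<mu> r * M r) * - (inverse (M r))\<^sup>2) (at r)"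
      using field_vector_diff_chain_at[OF dM DERIV_inverse[OF M]]
      by (simp add: o_def numeral_2_eq_2)
    from has_vector_derivative_mult[OF dN this] show ?thesis
      using M[of r] by (simp add: field_simps power2_eq_square)
  qed
  then obtain a where a: "N r * inverse (M r) = a" for r
    by (rule has_vector_derivative_zero_constant[OF convex_UNIV]) auto
  have "Z 0 = \<psi> w" using flow w by (auto simp: aut_flow_def Z_def)
  then have "a = \<psi> w"
    using a[of 0] by (simp add: N_def M_def c_def q_def)
  then have "N s = \<psi> w * M s"
    using a[of s] M[of s] by (simp add: field_simps)
  then have "Z s * den s (\<psi> w) = num s (\<psi> w)"
    by (simp add: N_def M_def c_def q_def num_def den_def al_def be_def ga_def de_def algebra_simps)
  then show ?thesis
    using den_nonzero[of "\<psi> w" s] Im_\<psi>[OF w] by (simp add: Z_def field_simps)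
qed

text \<open>\<open>aut_flow\<close> speaks of derivatives in time only. Complex differentiability in
  space comes from writing \<open>h s\<close> on all of \<open>D\<close> as a Moebius map conjugated
  by \<phi>.\<close>

lemma deriv_flow:
  assumes w: "w \<in> D"
  shows "deriv (h s) w = deriv \<phi> (\<psi> (h s w)) * deriv \<psi> w / (den s (\<psi> w))\<^sup>2"
proof -
  have hD: "h s w \<in> D" if "w \<in> D" for w using flow that by (auto simp: aut_flow_def)
  have den: "den s (\<psi> w) \<noteq> 0" if "w \<in> D" for w
    using den_nonzero[of "\<psi> w" s] Im_\<psi>[OF that] by simp
  have k: "((\<lambda>w. num s (\<psi> w) / den s (\<psi> w)) has_field_derivative deriv \<psi> w / (den s (\<psi> w))\<^sup>2) (at w)"
  proof -
    have "(num s has_field_derivative of_real (al s)) (at (\<psi> w))"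
         "(den s has_field_derivative of_real (ga s)) (at (\<psi> w))"
      unfolding num_def[abs_def] den_def[abs_def] by (auto intro!: derivative_eq_intros)
    then have "((\<lambda>w. num s (\<psi> w)) has_field_derivative of_real (al s) * deriv \<psi> w) (at w)"
      "((\<lambda>w. den s (\<psi> w)) has_field_derivative of_real (ga s) * deriv \<psi> w) (at w)"
      by (auto intro: DERIV_chain2 DERIV_\<psi> w)
    from DERIV_divide[OF this den[OF w]]
    have "((\<lambda>w. num s (\<psi> w) / den s (\<psi> w)) has_field_derivative
      (of_real (al s) * deriv \<psi> w * den s (\<psi> w) - num s (\<psi> w) * (of_real (ga s) * deriv \<psi> w))
        / (den s (\<psi> w) * den s (\<psi> w))) (at w)" .
    moreover have "of_real (al s) * deriv \<psi> w * den s (\<psi> w) - num s (\<psi> w) * (of_real (ga s) * deriv \<psi> w)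
       = deriv \<psi> w"
      using det_complex[of s] unfolding num_def den_def by algebra
    ultimately show ?thesis by (simp add: power2_eq_square)
  qed
  have "(\<phi> has_field_derivative deriv \<phi> (\<psi> (h s w))) (at (num s (\<psi> w) / den s (\<psi> w)))"
    unfolding flow_eq_moebius[OF w, symmetric] by (rule DERIV_\<phi>[OF \<psi>(1)[OF hD[OF w]]])
  from DERIV_chain2[OF this k]
  have "((\<lambda>w. \<phi> (num s (\<psi> w) / den s (\<psi> w))) has_field_derivative
      deriv \<phi> (\<psi> (h s w)) * (deriv \<psi> w / (den s (\<psi> w))\<^sup>2)) (at w)" .
  moreover have "\<phi> (num s (\<psi> w) / den s (\<psi> w)) = h s w" if "w \<in> D" for w
    using flow_eq_moebius[OF that, symmetric] \<psi>(2)[OF hD[OF that]] by simp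
  ultimately have "(h s has_field_derivative deriv \<phi> (\<psi> (h s w)) * (deriv \<psi> w / (den s (\<psi> w))\<^sup>2)) (at w)"
    using has_field_derivative_transform_within_open[OF _ open_D w] by blast
  then show ?thesis by (simp add: DERIV_imp_deriv)
qed

text \<open>The derivative of \<phi> at \<open>h (u t) w\<close> occurs in b and in the derivative
  of the flow and cancels; the factor \<open>deriv \<psi> w\<close> then removes the rest of the
  coordinate change.\<close>

lemma loewner_vf_eq:
  assumes w: "w \<in> D"
  shows "loewner_vf b h u t w * deriv \<psi> w = vf (u t) (\<psi> w)"
proof -
  have hD: "h (u t) w \<in> D" using flow w by (auto simp: aut_flow_def)
  define n d p q where "n = num (u t) (\<psi> w)" and "d = den (u t) (\<psi> w)"
    and "p = deriv \<phi> (\<psi> (h (u t) w))" and "q = deriv \<psi> w"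
  have nz: "n \<noteq> 0" "d \<noteq> 0"
    using num_nonzero den_nonzero Im_\<psi>[OF w] by (auto simp: n_def d_def)
  have pq: "p \<noteq> 0" "q \<noteq> 0"
    using deriv_\<psi>[OF hD] deriv_\<psi>[OF w] by (auto simp: p_def q_def)
  have "loewner_vf b h u t w * q =
      p * (2 / (n / d) + of_real bm1 + of_real b0 * (n / d) + of_real b1 * (n / d)\<^sup>2) / (p * q / d\<^sup>2) * q"
    unfolding loewner_vf_def loewner_b_eq[OF hD] deriv_flow[OF w] flow_eq_moebius[OF w] n_def d_def p_def q_def
    by simp
  also have "\<dots> = vf (u t) (\<psi> w)"
    unfolding vf_def n_def[symmetric] d_def[symmetric]
    using nz pq by (simp add: field_simps power2_eq_square power3_eq_cube)
  finally show ?thesis by (simp add: q_def)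
qed

section \<open>From chains in the domain to trajectories in the half plane\<close>

lemma ode_sol_imp_sol:
  assumes "ode_sol D (loewner_vf b h u) z t \<gamma>"
  shows "sol u t (\<lambda>s. \<psi> (\<gamma> s))"
  unfolding sol_def
proof
  fix s assume "s \<in> {0..t}"
  then have s: "\<gamma> s \<in> D" "(\<gamma> has_vector_derivative loewner_vf b h u s (\<gamma> s)) (at s within {0..t})"
    using assms by (auto simp: ode_sol_def)
  from \<psi>_chain[OF s(2,1)] Im_\<psi>[OF s(1)]
  show "Im (\<psi> (\<gamma> s)) > 0 \<and>
      ((\<lambda>s. \<psi> (\<gamma> s)) has_vector_derivative vf (u s) (\<psi> (\<gamma> s))) (at s within {0..t})"
    by (simp add: loewner_vf_eq[OF s(1)])
qed

lemma dom_antimono: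
  assumes "s \<le> t"
  shows "dom u t \<subseteq> dom u s"
proof -
  have "ode_sol D F z s \<gamma>" if "ode_sol D F z t \<gamma>" for F z \<gamma>
    using that assms has_vector_derivative_within_subset[of \<gamma> _ _ "{0..t}" "{0..s}"]
    unfolding ode_sol_def by auto
  then show ?thesis unfolding loewner_dom_def by blast
qed

text \<open>A chain provides a solution for each time s separately, and only its value at s is tied
  to \<open>g s z\<close>. Uniqueness identifies these solutions, so that s \<mapsto>
  \<open>g s z\<close> itself is one trajectory.\<close>

lemma chain_sol:
  assumes ch: "loewner_chain D b h u g" and "t \<ge> 0" and z: "z \<in> dom u t"
  shows "sol u t (\<lambda>s. \<psi> (g s z))" "\<psi> (g 0 z) = \<psi> z"
proof -
  have cont: "continuous_on {0..} u" using ch by (simp add: loewner_chain_def)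
  have ex: "\<exists>\<gamma>. ode_sol D (loewner_vf b h u) z s \<gamma> \<and> g s z = \<gamma> s" if "s \<in> {0..t}" for s
    using ch that dom_antimono[of s t u] z unfolding loewner_chain_def by auto
  obtain \<gamma> where \<gamma>: "ode_sol D (loewner_vf b h u) z t \<gamma>"
    using ex[of t] assms(2) by auto
  have eq: "\<psi> (\<gamma> s) = \<psi> (g s z)" if s: "s \<in> {0..t}" for s
  proof -
    obtain \<gamma>' where \<gamma>': "ode_sol D (loewner_vf b h u) z s \<gamma>'" "g s z = \<gamma>' s"
      using ex[OF s] by auto
    have "\<psi> (\<gamma> s) = \<psi> (\<gamma>' s)"
    proof (rule sol_unique[where u = u and T = s])
      show "sol u s (\<lambda>s. \<psi> (\<gamma> s))"
        using sol_subset[OF ode_sol_imp_sol[OF \<gamma>]] s by auto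
      show "sol u s (\<lambda>s. \<psi> (\<gamma>' s))" by (rule ode_sol_imp_sol[OF \<gamma>'(1)])
      show "continuous_on {0..s} u" using cont by (rule continuous_on_subset) auto
    qed (use \<gamma> \<gamma>' s in \<open>auto simp: ode_sol_def\<close>)
    with \<gamma>' show ?thesis by simp
  qed
  show "sol u t (\<lambda>s. \<psi> (g s z))"
    unfolding sol_def
  proof
    fix s assume s: "s \<in> {0..t}"
    from solD[OF ode_sol_imp_sol[OF \<gamma>] s] eq[OF s]
    show "Im (\<psi> (g s z)) > 0 \<and>
      ((\<lambda>s. \<psi> (g s z)) has_vector_derivative vf (u s) (\<psi> (g s z))) (at s within {0..t})"
      using has_vector_derivative_transform[OF s eq[symmetric]] by auto
  qed
  show "\<psi> (g 0 z) = \<psi> z"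
    using eq[of 0] \<gamma> assms(2) by (auto simp: ode_sol_def)
qed

lemma chain_bij:
  "loewner_chain D b h u g \<Longrightarrow> t \<ge> 0 \<Longrightarrow> bij_betw (g t) (dom u t) D"
  by (simp add: loewner_chain_def)

end

section \<open>Global coincidence\<close>

text \<open>The quantity compared is 2 (cosh d - 1) for the hyperbolic distance d, so p is a
  hyperbolic contraction. What remains is to turn this into Euclidean continuity.\<close>

lemma hyperbolic_continuity:
  fixes p :: "complex \<Rightarrow> complex"
  assumes "open S" and im: "\<And>w. w \<in> S \<Longrightarrow> Im w > 0" "\<And>w. w \<in> S \<Longrightarrow> Im (p w) > 0"
    and contr: "\<And>w v. w \<in> S \<Longrightarrow> v \<in> S \<Longrightarrow>
      (cmod (p w - p v))\<^sup>2 / (Im (p w) * Im (p v)) \<le> (cmod (w - v))\<^sup>2 / (Im w * Im v)"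
  shows "continuous_on S p"
  unfolding continuous_on_def
proof
  fix v assume v: "v \<in> S"
  define d where "d w = (cmod (w - v))\<^sup>2 / (Im w * Im v)" for w
  have "(d \<longlongrightarrow> (cmod (v - v))\<^sup>2 / (Im v * Im v)) (at v within S)"
    unfolding d_def using im(1)[OF v] by (intro tendsto_intros) auto
  then have d0: "(d \<longlongrightarrow> 0) (at v within S)" by simp
  then have "((\<lambda>w. 2 * Im (p v) * sqrt (d w)) \<longlongrightarrow> 2 * Im (p v) * sqrt 0) (at v within S)"
    by (intro tendsto_intros)
  then have lim: "((\<lambda>w. 2 * Im (p v) * sqrt (d w)) \<longlongrightarrow> 0) (at v within S)" by simp
  have "eventually (\<lambda>w. d w < 1) (at v within S)"
    using d0 by (rule order_tendstoD) simp
  moreover have "eventually (\<lambda>w. w \<in> S) (at v within S)"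
    by (simp add: eventually_at_filter)
  \<comment> \<open>With r the distance of the values, P the height of \<open>p v\<close> and e the
    root of \<open>d w\<close>, contraction gives r^2 \<le> e^2 (P + r) P, because the height of
    \<open>p w\<close> is at most P + r. If r > 2 P e and e \<le> 1, the right side is at most r^2/4
    + r^2/2, a contradiction; hence the factor 2.\<close>
  ultimately have "eventually (\<lambda>w. norm (p w - p v) \<le> 2 * Im (p v) * sqrt (d w)) (at v within S)"
  proof eventually_elim
    case (elim w)
    define r P e where "r = cmod (p w - p v)" and "P = Im (p v)" and "e = sqrt (d w)"
    have P: "P > 0" using im(2)[OF v] by (simp add: P_def)
    have d: "d w \<ge> 0" using im(1)[OF v] im(1)[OF elim(2)] by (simp add: d_def)
    have e: "0 \<le> e" "e \<le> 1" "d w = e\<^sup>2" using d elim by (auto simp: e_def)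
    have "r\<^sup>2 \<le> d w * (Im (p w) * P)"
      using contr[OF elim(2) v] im(2)[OF v] im(2)[OF elim(2)]
      by (simp add: d_def r_def P_def divide_le_eq)
    also have "Im (p w) \<le> P + r"
      using abs_Im_le_cmod[of "p w - p v"] by (simp add: r_def P_def)
    finally have r2: "r\<^sup>2 \<le> e\<^sup>2 * ((P + r) * P)"
      using e P by (simp add: mult_left_mono mult_right_mono)
    have "r \<le> 2 * P * e"
    proof (rule ccontr)
      assume "\<not> r \<le> 2 * P * e"
      then have r: "r > 2 * P * e" by simp
      have "e\<^sup>2 * ((P + r) * P) = (P * e)\<^sup>2 + e * (r * (P * e))"
        by (simp add: power2_eq_square algebra_simps)
      also have "\<dots> \<le> (P * e)\<^sup>2 + r * (P * e)"
        using e P r by (intro add_left_mono mult_left_le_one_le) (auto simp: r_def)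
      also have "\<dots> < r\<^sup>2"
      proof -
        have a: "P * e \<ge> 0" "P * e < r / 2" using P e r by auto
        then have "(P * e)\<^sup>2 \<le> (r / 2)\<^sup>2" "r * (P * e) \<le> r * (r / 2)" and "r > 0"
          by (auto intro!: power_mono mult_left_mono)
        then have "(P * e)\<^sup>2 \<le> r\<^sup>2 / 4" "r * (P * e) \<le> r\<^sup>2 / 2" "r\<^sup>2 > 0"
          by (simp_all add: power_divide power2_eq_square)
        then show ?thesis by linarith
      qed
      finally show False using r2 by simp
    qed
    then show ?case by (simp add: r_def P_def e_def)
  qed
  then have "((\<lambda>w. p w - p v) \<longlongrightarrow> 0) (at v within S)"
    by (rule Lim_null_comparison[OF _ lim])
  then show "(p \<longlongrightarrow> p v) (at v within S)"
    by (simp add: LIM_zero_iff)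
qed

section \<open>Open domains, the comparison automorphism, and continuation in time\<close>

context loewner_setting
begin

lemma open_dom:
  assumes ch: "loewner_chain D b h u g" and t: "t \<ge> 0"
  shows "open (dom u t)"
proof -
  define p where "p w = \<psi> (inv_into (dom u t) (g t) (\<phi> w))" for w
  have bg: "bij_betw (g t) (dom u t) D" by (rule chain_bij[OF ch t])
  have sub: "dom u t \<subseteq> D" by (auto simp: loewner_dom_def)
  have inv: "inv_into (dom u t) (g t) (\<phi> w) \<in> dom u t" "g t (inv_into (dom u t) (g t) (\<phi> w)) = \<phi> w"
    if "w \<in> upper_half" for w
    using bg \<psi>(4)[OF that] by (auto simp: bij_betw_def inv_into_into f_inv_into_f)
  have ps: "\<psi> (g 0 (inv_into (dom u t) (g t) (\<phi> w))) = p w"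
    "\<psi> (g t (inv_into (dom u t) (g t) (\<phi> w))) = w" if "w \<in> upper_half" for w
    using chain_sol(2)[OF ch t inv(1)[OF that]] inv(2)[OF that] \<psi>(3)[OF that] by (auto simp: p_def)
  have "continuous_on upper_half p"
  proof (rule hyperbolic_continuity[OF open_upper_half])
    fix w v assume wv: "w \<in> upper_half" "v \<in> upper_half"
    show "(cmod (p w - p v))\<^sup>2 / (Im (p w) * Im (p v)) \<le> (cmod (w - v))\<^sup>2 / (Im w * Im v)"
      using hyperbolic_distance_nondecreasing[OF chain_sol(1)[OF ch t inv(1)[OF wv(1)]]
          chain_sol(1)[OF ch t inv(1)[OF wv(2)]] t]
      by (simp only: ps wv)
  qed (use inv(1) sub Im_\<psi> in \<open>auto simp: p_def upper_half_def\<close>)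
  moreover have "inj_on p upper_half"
  proof (rule inj_onI)
    fix w v assume wv: "w \<in> upper_half" "v \<in> upper_half" "p w = p v"
    then have "inv_into (dom u t) (g t) (\<phi> w) = inv_into (dom u t) (g t) (\<phi> v)"
      using \<psi>_eq_iff inv(1) sub unfolding p_def by blast
    then have "\<phi> w = \<phi> v" using inv(2) wv by metis
    then show "w = v" using \<psi>(3) wv by metis
  qed
  ultimately have "open (p ` upper_half)"
    using invariance_of_domain open_upper_half by blast
  then have "open (D \<inter> \<psi> -` (p ` upper_half))"
    using continuous_open_preimage[OF holomorphic_on_imp_continuous_on[OF hol_\<psi>] open_D] by blast
  also have "D \<inter> \<psi> -` (p ` upper_half) = dom u t"
  proof (intro equalityI subsetI)
    fix z assume "z \<in> D \<inter> \<psi> -` (p ` upper_half)"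
    then obtain w where w: "z \<in> D" "w \<in> upper_half" "\<psi> z = p w" by auto
    then have "z = inv_into (dom u t) (g t) (\<phi> w)"
      using \<psi>_eq_iff inv(1) sub unfolding p_def by blast
    then show "z \<in> dom u t" using inv(1)[OF w(2)] by simp
  next
    fix z assume z: "z \<in> dom u t"
    then have gz: "g t z \<in> D" using bg by (auto simp: bij_betw_def)
    have "inv_into (dom u t) (g t) (\<phi> (\<psi> (g t z))) = z"
      using bg z \<psi>(2)[OF gz] by (simp add: bij_betw_def)
    then have "p (\<psi> (g t z)) = \<psi> z" by (simp add: p_def)
    then show "z \<in> D \<inter> \<psi> -` (p ` upper_half)"
      using \<psi>(1)[OF gz] z sub by (metis IntI image_eqI subsetD vimageI)
  qed
  finally show ?thesis .
qed

text \<open>Because the domains coincide, one map can be followed after the inverse of the other.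
  Openness of the domain makes that inverse holomorphic.\<close>

lemma chain_automorphism:
  assumes g: "loewner_chain D b h u g" "t \<ge> 0" and gt: "loewner_chain D b h ut gt" "t' \<ge> 0"
    and eq: "dom ut t' = dom u t"
  obtains f where "f holomorphic_on upper_half" "bij_betw f upper_half upper_half"
    "\<And>z. z \<in> dom u t \<Longrightarrow> f (\<psi> (g t z)) = \<psi> (gt t' z)"
proof -
  have bg: "bij_betw (g t) (dom u t) D" and bgt: "bij_betw (gt t') (dom u t) D"
    using chain_bij[OF g] chain_bij[OF gt] eq by auto
  have hg: "g t holomorphic_on dom u t" and hgt: "gt t' holomorphic_on dom u t"
    using g gt eq unfolding loewner_chain_def by auto
  have im: "g t ` dom u t = D" and inj: "inj_on (g t) (dom u t)" using bg by (auto simp: bij_betw_def)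
  obtain G where G: "G holomorphic_on D" "\<And>z. z \<in> dom u t \<Longrightarrow> G (g t z) = z"
    using holomorphic_has_inverse[OF hg open_dom[OF g] inj] unfolding im by metis
  have bG: "bij_betw G D (dom u t)"
  proof -
    have GD: "g t (G a) = a \<and> G a \<in> dom u t" if "a \<in> D" for a
    proof -
      have "a \<in> g t ` dom u t" by (simp only: im that)
      then show ?thesis by (auto simp: G(2))
    qed
    show ?thesis
    proof (rule bij_betw_byWitness[where f' = "g t"])
      show "g t ` dom u t \<subseteq> D" by (simp only: im subset_refl)
    qed (use GD G(2) in auto)
  qed
  define f where "f = \<psi> \<circ> (gt t' \<circ> (G \<circ> \<phi>))"
  show ?thesis
  proof (rule that)
    have im': "\<phi> ` upper_half = D" "G ` D = dom u t" "gt t' ` dom u t = D"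
      using bij bG bgt by (auto simp: bij_betw_def)
    show "f holomorphic_on upper_half"
    proof -
      have "G \<circ> \<phi> holomorphic_on upper_half"
        by (rule holomorphic_on_compose_gen[OF hol G(1)]) (simp add: im')
      then have "gt t' \<circ> (G \<circ> \<phi>) holomorphic_on upper_half"
        by (rule holomorphic_on_compose_gen[OF _ hgt]) (simp only: image_comp[symmetric] im' subset_refl)
      then show ?thesis
        unfolding f_def
        by (rule holomorphic_on_compose_gen[OF _ hol_\<psi>]) (simp only: image_comp[symmetric] im' subset_refl)
    qed
    show "bij_betw f upper_half upper_half"
      unfolding f_def by (rule bij_betw_trans bij bG bgt bij_\<psi>)+
    show "f (\<psi> (g t z)) = \<psi> (gt t' z)" if "z \<in> dom u t" for z
    proof -
      have "g t z \<in> D" using im that by auto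
      then show ?thesis by (simp add: f_def \<psi>(2) G(2)[OF that])
    qed
  qed
qed

text \<open>Continuation argument: the set of times with coincidence is closed by continuity, and a
  first failure time m is excluded by the local result to the right of m.\<close>

theorem chains_agree:
  assumes g: "loewner_chain D b h u g" and gt: "loewner_chain D b h ut gt"
    and lam: "continuous_on {0..} lam" "mono_on {0..} lam" "lam 0 = 0"
    and eq: "\<And>t. t \<ge> 0 \<Longrightarrow> dom ut (lam t) = dom u t" and "t \<ge> 0"
  shows "lam t = t" "ut t = u t"
proof -
  have cont: "continuous_on {0..} u" "continuous_on {0..} ut" and zero: "u 0 = 0" "ut 0 = 0"
    using g gt by (auto simp: loewner_chain_def)
  have lam0: "lam t \<ge> 0" if "t \<ge> 0" for t
    using mono_onD[OF lam(2), of 0 t] lam(3) that by simp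
  define P where "P t \<longleftrightarrow> lam t = t \<and> ut t = u t" for t
  have step: "eventually P (at_right m)" if "m \<ge> 0" and P: "\<And>s. s \<in> {0..m} \<Longrightarrow> P s" for m
  proof -
    \<comment> \<open>Any time beyond m would do: the trajectories must survive past m for the
      right-hand comparison.\<close>
    define T where "T = m + 1"
    have T: "0 \<le> T" "m < T" using that by (auto simp: T_def)
    \<comment> \<open>Five distinct starting points are needed; a nonempty open set contains
      infinitely many.\<close>
    have "infinite (dom u T)"
    proof
      assume "finite (dom u T)"
      then have "dom u T = {}"
        using finite_imp_not_open[of "dom u T"] open_dom[OF g T(1)] by blast
      then have "D = {}" using chain_bij[OF g T(1)] by (simp add: bij_betw_def)
      then show False using \<psi>(4)[of \<i>] by (auto simp: upper_half_def)
    qed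
    then obtain e :: "nat \<Rightarrow> complex" where e: "inj e" "range e \<subseteq> dom u T"
      using infinite_countable_subset by blast
    have eT: "e i \<in> dom u T" for i using e(2) by auto
    have eT': "e i \<in> dom ut (lam T)" for i using eT eq[OF T(1)] by simp
    have et: "e i \<in> dom u t" "e i \<in> dom ut (lam t)" if "t \<in> {0..T}" for i t
      using that eT[of i] dom_antimono[of t T u] eq[of t] by auto
    define x where "x i s = \<psi> (g s (e i))" for i s
    define Y where "Y i s = \<psi> (gt s (e i))" for i s
    have x: "sol u T (x i)" for i
      unfolding x_def by (rule chain_sol(1)[OF g T(1) eT])
    have Y: "sol ut (lam T) (Y i)" for i
      unfolding Y_def by (rule chain_sol(1)[OF gt lam0[OF T(1)] eT'])
    have inj: "\<psi> (k s z) \<noteq> \<psi> (k s w)"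
      if "loewner_chain D b h v k" "s \<ge> 0" "z \<in> dom v s" "w \<in> dom v s" "z \<noteq> w" for v k s z w
      using chain_bij[OF that(1,2)] that(3-5) \<psi>_eq_iff[of "k s z" "k s w"]
      by (auto simp: bij_betw_def inj_on_def)
    have "eventually (\<lambda>t. lam t - lam m = t - m \<and> ut (lam t) = u t) (at_right m)"
    proof (rule chains_agree_locally[where x = x and Y = Y, OF that(1) T(2) x Y cont lam])
      fix i j :: nat and t assume "i \<noteq> j" and t: "t \<in> {0..T}"
      then have ij: "e i \<noteq> e j" using e(1) by (auto simp: inj_def)
      show "x i t \<noteq> x j t"
        unfolding x_def by (rule inj[OF g _ et(1)[OF t] et(1)[OF t] ij]) (use t in simp)
      show "Y i (lam t) \<noteq> Y j (lam t)"
        unfolding Y_def by (rule inj[OF gt lam0 et(2)[OF t] et(2)[OF t] ij]) (use t in simp)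
    next
      fix i j k l :: nat and t assume t: "t \<in> {0..T}"
      then have t0: "t \<ge> 0" by simp
      obtain f where f: "f holomorphic_on upper_half" "bij_betw f upper_half upper_half"
          "\<And>z. z \<in> dom u t \<Longrightarrow> f (\<psi> (g t z)) = \<psi> (gt (lam t) z)"
        using chain_automorphism[OF g t0 gt lam0[OF t0] eq[OF t0]] by blast
      have xH: "x i t \<in> upper_half" for i
        using solD(1)[OF x t] by (simp add: upper_half_def)
      have "f (x i t) = Y i (lam t)" for i
        unfolding x_def Y_def by (rule f(3)[OF et(1)[OF t]])
      then show "(x i t - x j t) * (x k t - x l t) * ((Y i (lam t) - Y k (lam t)) * (Y j (lam t) - Y l (lam t)))
       = (Y i (lam t) - Y j (lam t)) * (Y k (lam t) - Y l (lam t)) * ((x i t - x k t) * (x j t - x l t))"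
        using upper_half_automorphism_cross_ratio[OF f(1,2) xH xH xH xH] by metis
    next
      have m: "m \<in> {0..m}" using that(1) by simp
      show "ut (lam m) = u m" using P[OF m] by (simp add: P_def)
      fix i :: nat
      \<comment> \<open>The trajectories of the second chain are known to live up to
        \<open>lam T\<close>; monotonicity shows that this reaches m.\<close>
      have "m \<le> lam T"
        using mono_onD[OF lam(2), of m T] P[OF m] T that(1) by (simp add: P_def)
      then have "sol ut m (Y i)" by (rule sol_subset[OF Y])
      \<comment> \<open>Here coincidence is needed on all of [0, m]: with equal driving functions
        both trajectories solve one equation, so equal starting points give equal positions at
        m.\<close>
      then have "sol u m (Y i)" using P by (simp add: sol_def P_def)
      moreover have "sol u m (x i)" using sol_subset[OF x] T by simp
      moreover have "Y i 0 = x i 0"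
        unfolding x_def Y_def by (simp only: chain_sol(2)[OF g T(1) eT] chain_sol(2)[OF gt lam0[OF T(1)] eT'])
      moreover have "continuous_on {0..m} u" using cont(1) by (rule continuous_on_subset) auto
      ultimately have "Y i m = x i m" using sol_unique m by blast
      then show "Y i (lam m) = x i m" using P[OF m] by (simp add: P_def)
    qed
    moreover have "lam m = m" using P[of m] that(1) by (simp add: P_def)
    ultimately show ?thesis
      by (auto simp: P_def elim!: eventually_mono)
  qed
  have "P t" if "t \<ge> 0" for t
  proof (rule ccontr)
    assume "\<not> P t"
    define B where "B = {t. t \<ge> 0 \<and> \<not> P t}"
    define m where "m = Inf B"
    have B: "B \<noteq> {}" "bdd_below B" using \<open>\<not> P t\<close> that by (auto simp: B_def intro: bdd_belowI[of _ 0])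
    have m: "m \<ge> 0" unfolding m_def using B(1) by (rule cInf_greatest) (simp add: B_def)
    have below: "P s" if "0 \<le> s" "s < m" for s
      using cInf_lower[OF _ B(2), of s] that by (force simp: B_def m_def)
    have "P m"
    proof (cases "m = 0")
      case True
      then show ?thesis using zero lam(3) by (simp add: P_def)
    next
      case False
      have "closed {t \<in> {0..}. lam t - t = 0}" "closed {t \<in> {0..}. ut t - u t = 0}"
        by (intro continuous_closed_preimage_constant continuous_intros lam cont closed_atLeast)+
      then have "closed ({t \<in> {0..}. lam t - t = 0} \<inter> {t \<in> {0..}. ut t - u t = 0})"
        by (rule closed_Int)
      moreover have "{0..<m} \<subseteq> {t \<in> {0..}. lam t - t = 0} \<inter> {t \<in> {0..}. ut t - u t = 0}"
        using below by (auto simp: P_def)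
      ultimately have "closure {0..<m} \<subseteq> {t \<in> {0..}. lam t - t = 0} \<inter> {t \<in> {0..}. ut t - u t = 0}"
        by (intro closure_minimal)
      then show ?thesis using False m by (auto simp: closure_atLeastLessThan P_def)
    qed
    then have "eventually P (at_right m)"
      using below m by (intro step) (auto simp: less_le)
    then obtain c where c: "c > m" "\<And>s. m < s \<Longrightarrow> s < c \<Longrightarrow> P s"
      by (auto simp: eventually_at_right_field)
    have "c \<le> m"
      unfolding m_def using B(1)
    proof (rule cInf_greatest)
      fix s assume "s \<in> B"
      then show "c \<le> s"
        using c below[of s] \<open>P m\<close> by (force simp: B_def not_le[symmetric] dest: less_imp_le)
    qed
    with c show False by simp
  qed
  with \<open>t \<ge> 0\<close> show "lam t = t" "ut t = u t" by (auto simp: P_def)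
qed

end

theorem mainTheorem8:
  fixes D :: "complex set" and \<phi> :: "complex \<Rightarrow> complex"
    and bm1 b0 b1 s0 s1 :: real
    and h :: "real \<Rightarrow> complex \<Rightarrow> complex"
    and u ut :: "real \<Rightarrow> real"
    and g gt :: "real \<Rightarrow> complex \<Rightarrow> complex"
    and lam :: "real \<Rightarrow> real"
  assumes "open D" and "connected D" and "simply_connected D" and "D \<noteq> UNIV"
    and "\<phi> holomorphic_on upper_half" and "bij_betw \<phi> upper_half D"
    and "aut_flow D (loewner_sigma \<phi> s0 s1) h"
    and "loewner_chain D (loewner_b \<phi> bm1 b0 b1) h u g"
    and "loewner_chain D (loewner_b \<phi> bm1 b0 b1) h ut gt"
    and "continuous_on {0..} lam" and "mono_on {0..} lam" and "lam 0 = 0"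
    and "\<forall>t\<ge>0. loewner_dom D (loewner_b \<phi> bm1 b0 b1) h ut (lam t)
                = loewner_dom D (loewner_b \<phi> bm1 b0 b1) h u t"
  shows "\<forall>t\<ge>0. lam t = t \<and> ut (lam t) = u t \<and>
           (\<forall>z\<in>loewner_dom D (loewner_b \<phi> bm1 b0 b1) h u t. g t z = gt (lam t) z)"
proof -
  interpret loewner_setting bm1 b0 b1 s0 s1 D \<phi> h
    using assms by unfold_locales
  note agree = chains_agree[OF assms(8-12)]
  have lam: "lam t = t" and ut: "ut t = u t" if "t \<ge> 0" for t
    using agree assms(13) that by blast+
  \<comment> \<open>With the driving functions equal, both chains follow the same equation from z,
    and injectivity of \<psi> carries uniqueness back to \<open>D\<close>.\<close>
  have "g t z = gt t z" if t: "t \<ge> 0" and z: "z \<in> dom u t" for t z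
  proof -
    have z': "z \<in> dom ut t" using assms(13) lam[OF t] t z by metis
    have "\<psi> (g t z) = \<psi> (gt t z)"
    proof (rule sol_unique[where u = u and T = t])
      show "sol u t (\<lambda>s. \<psi> (g s z))" by (rule chain_sol(1)[OF assms(8) t z])
      show "sol u t (\<lambda>s. \<psi> (gt s z))"
        using chain_sol(1)[OF assms(9) t z'] ut by (simp add: sol_def)
      show "continuous_on {0..t} u"
        using assms(8) by (auto simp: loewner_chain_def intro: continuous_on_subset)
      show "\<psi> (g 0 z) = \<psi> (gt 0 z)"
        by (simp only: chain_sol(2)[OF assms(8) t z] chain_sol(2)[OF assms(9) t z'])
    qed (use t in simp)
    moreover have "g t z \<in> D" "gt t z \<in> D"
      using chain_bij[OF assms(8) t] chain_bij[OF assms(9) t] z z' by (auto simp: bij_betw_def)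
    ultimately show ?thesis by (simp add: \<psi>_eq_iff)
  qed
  with lam ut show ?thesis by simp
qed

end
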